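(* Let $\mathcal{H}$ be a countable family of simple graphs of bounded minimum branching core size, i.e. $\{\underline{\mathrm{bc}}(H):H\in\mathcal{H}\}$ is bounded. Then $\mathcal{H}$ can be partitioned into finitely many subsets $\mathcal{H}_\ell$, $1\le\ell\le m$, each indexed as $\mathcal{H}_\ell=(H_{\mathbf{k}_\ell}:\mathbf{k}_\ell\in I_\ell)$ for some $I_\ell\subseteq\mathbb{N}^{h_\ell}$ ($h_\ell\ge1$), such that for each $\ell$: (i) there is a rooted tree $T_\ell$ with $|V(T_\ell)|=h_\ell$ and a fixed graph $G_\ell\subseteq\mathrm{clos}(T_\ell)$ (spanning subgraph) such that $H_{\mathbf{k}_\ell}=T_\ell^{\mathbf{k}_\ell}(G_\ell)$ for every $\mathbf{k}_\ell\in I_\ell$; and (ii) $(H_{\mathbf{k}_\ell})$, indexed by $\mathbf{k}_\ell\in I_\ell$, is a strongly polynomial subsequence.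
   Context: Graphs are finite; $\mathrm{hom}(G,H)$ is the number of homomorphisms from $G$ to $H$. $\mathbb{N}$ denotes the positive integers. A sequence $(H_{\mathbf{k}})$ indexed by all $\mathbf{k}\in\mathbb{N}^h$ is strongly polynomial if for every graph $G$ there is a polynomial $p(G;x_1,\dots,x_h)$ with $\mathrm{hom}(G,H_{\mathbf{k}})=p(G;\mathbf{k})$ for all $\mathbf{k}$. A sequence $(F_{\mathbf{k}})$ indexed by $I\subseteq\mathbb{N}^h$ is a strongly polynomial subsequence if there is a strongly polynomial sequence $(H_{\mathbf{k}})_{\mathbf{k}\in\mathbb{N}^h}$ with $H_{\mathbf{k}}=F_{\mathbf{k}}$ for $\mathbf{k}\in I$. Rooted trees: for a rooted tree $T$ with root $r$, $P(s)$ is the vertex set of the path from $r$ to $s$ (including both); $t\ne s$ is an ancestor of $s$ if $t\in P(s)$; the level of $s$ is $|P(s)|-1$. $\mathrm{clos}(T)$ is the simple graph on $V(T)$ with $s\ne t$ adjacent iff one is an ancestor of the other. Branching: for $\mathbf{k}=(k_s)_{s\in V(T)}\in\mathbb{N}^{|V(T)|}$, $T^{\mathbf{k}}$ is the rooted forest whose vertices are pairs $(s,\varphi)$ with $s\in V(T)$ and $\varphi$ assigning to each $t\in P(s)$ an element of $\{1,\dots,k_t\}$, where $(t,\psi)$ is an ancestor of $(s,\varphi)$ iff $t$ is an ancestor of $s$ and $\psi=\varphi|_{P(t)}$. For a spanning subgraph $G$ of $\mathrm{clos}(T)$, $T^{\mathbf{k}}(G)$ is the simple graph on $V(T^{\mathbf{k}})$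 where $(s,\varphi)$ and an ancestor $(t,\psi)$ (so $\psi=\varphi|_{P(t)}$) are adjacent iff $st\in E(G)$, and there are no other edges. Minimum branching core size: given a simple graph $H$ and a rooted tree $T$ with $V(T)=V(H)$ such that $H$ is a spanning subgraph of $\mathrm{clos}(T)$, colour each $s\in V(T)$ by $A_s=\{\text{level of }t: t\text{ an ancestor of }s,\ st\in E(H)\}$. The branching core size $\mathrm{bc}(T)$ is the number of orbits on $V(T)$ of the group of root- and colour-preserving automorphisms of the rooted tree $T$ (equivalently, the number of vertices left after repeatedly merging colour-isomorphic subtrees hanging from a common parent). $\underline{\mathrm{bc}}(H)$ is the minimum of $\mathrm{bc}(T)$ over all such rooted trees $T$. *)

theory Defs
  imports Main "HOL.Rat" "HOL-Library.FuncSet" "HOL-Library.Disjoint_Sets"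
    "HOL-Library.Countable_Set" "HOL-Library.Extended_Nat" "HOL-Combinatorics.Permutations"
begin

text \<open>Undirected graphs. The edge \<open>{u, v}\<close> is a loop if \<open>u = v\<close>.\<close>

record 'a graph =
  verts :: "'a set"
  edges :: "'a set set"

definition finite_graph :: "'a graph \<Rightarrow> bool" where
  "finite_graph G \<longleftrightarrow>
     finite (verts G) \<and> (\<forall>e\<in>edges G. \<exists>u\<in>verts G. \<exists>v\<in>verts G. e = {u, v})"

definition simple_graph :: "'a graph \<Rightarrow> bool" where
  "simple_graph G \<longleftrightarrow> finite_graph G \<and> (\<forall>e\<in>edges G. card e = 2)"

definition spanning_subgraph :: "'a graph \<Rightarrow> 'a graph \<Rightarrow> bool" where
  "spanning_subgraph G K \<longleftrightarrow> verts G = verts K \<and> edges G \<subseteq> edges K"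

definition hom :: "'a graph \<Rightarrow> 'b graph \<Rightarrow> nat" where
  "hom G H = card {f \<in> verts G \<rightarrow>\<^sub>E verts H. \<forall>e\<in>edges G. f ` e \<in> edges H}"

definition is_graph_iso :: "('a \<Rightarrow> 'b) \<Rightarrow> 'a graph \<Rightarrow> 'b graph \<Rightarrow> bool" where
  "is_graph_iso f G H \<longleftrightarrow>
     bij_betw f (verts G) (verts H) \<and> (\<lambda>e. f ` e) ` edges G = edges H"

definition graph_iso :: "'a graph \<Rightarrow> 'b graph \<Rightarrow> bool" (infix "\<simeq>\<^sub>g" 50) where
  "G \<simeq>\<^sub>g H \<longleftrightarrow> (\<exists>f. is_graph_iso f G H)"


section \<open>Strongly polynomial sequences\<close>

text \<open>\<open>multi_indices h\<close> is the \<open>h\<close>-fold power of the set of positive integers,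
  with coordinates numbered from \<open>1\<close> to \<open>h\<close>.\<close>

definition multi_indices :: "nat \<Rightarrow> (nat \<Rightarrow> nat) set" where
  "multi_indices h = {1..h} \<rightarrow>\<^sub>E {1..}"

text \<open>\<open>M\<close> is the set of exponent vectors and \<open>c\<close> gives the coefficients. A real polynomial with
  integer values on \<open>multi_indices h\<close> has rational coefficients, so the choice of
  the rationals is no restriction.\<close>

definition polynomial_in :: "nat \<Rightarrow> ((nat \<Rightarrow> rat) \<Rightarrow> rat) \<Rightarrow> bool" where
  "polynomial_in h p \<longleftrightarrow>
     (\<exists>(M :: (nat \<Rightarrow> nat) set) c. finite M \<and>
        (\<forall>x. p x = (\<Sum>m\<in>M. c m * (\<Prod>i=1..h. x i ^ m i))))"

text \<open>Every finite graph has an isomorphic copy with vertices in \<^typ>\<open>nat\<close>, so the test graphs \<open>G\<close>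
  here, and the terms of the ambient sequence in the definition after this one, are taken there.\<close>

definition strongly_polynomial :: "nat \<Rightarrow> ((nat \<Rightarrow> nat) \<Rightarrow> 'a graph) \<Rightarrow> bool" where
  "strongly_polynomial h H \<longleftrightarrow>
     (\<forall>k\<in>multi_indices h. finite_graph (H k)) \<and>
     (\<forall>G :: nat graph. finite_graph G \<longrightarrow>
        (\<exists>p. polynomial_in h p \<and>
           (\<forall>k\<in>multi_indices h. of_nat (hom G (H k)) = p (\<lambda>i. of_nat (k i)))))"

definition strongly_polynomial_subsequence ::
    "nat \<Rightarrow> (nat \<Rightarrow> nat) set \<Rightarrow> ((nat \<Rightarrow> nat) \<Rightarrow> 'a graph) \<Rightarrow> bool" where
  "strongly_polynomial_subsequence h I F \<longleftrightarrow>
     I \<subseteq> multi_indices h \<and>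
     (\<exists>H :: (nat \<Rightarrow> nat) \<Rightarrow> nat graph. strongly_polynomial h H \<and> (\<forall>k\<in>I. H k \<simeq>\<^sub>g F k))"


section \<open>Rooted trees\<close>

definition is_path :: "'a graph \<Rightarrow> 'a \<Rightarrow> 'a list \<Rightarrow> 'a \<Rightarrow> bool" where
  "is_path G u p v \<longleftrightarrow>
     p \<noteq> [] \<and> hd p = u \<and> last p = v \<and> distinct p \<and> set p \<subseteq> verts G \<and>
     successively (\<lambda>x y. {x, y} \<in> edges G) p"

definition tree :: "'a graph \<Rightarrow> bool" where
  "tree T \<longleftrightarrow> simple_graph T \<and> verts T \<noteq> {} \<and>
     (\<forall>u\<in>verts T. \<forall>v\<in>verts T. \<exists>!p. is_path T u p v)"

definition rooted_tree :: "'a graph \<Rightarrow> 'a \<Rightarrow> bool" where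
  "rooted_tree T r \<longleftrightarrow> tree T \<and> r \<in> verts T"

definition root_path :: "'a graph \<Rightarrow> 'a \<Rightarrow> 'a \<Rightarrow> 'a set" where
  "root_path T r s = set (THE p. is_path T r p s)"

definition ancestor :: "'a graph \<Rightarrow> 'a \<Rightarrow> 'a \<Rightarrow> 'a \<Rightarrow> bool" where
  "ancestor T r t s \<longleftrightarrow> s \<in> verts T \<and> t \<noteq> s \<and> t \<in> root_path T r s"

definition level :: "'a graph \<Rightarrow> 'a \<Rightarrow> 'a \<Rightarrow> nat" where
  "level T r s = card (root_path T r s) - 1"

definition clos :: "'a graph \<Rightarrow> 'a \<Rightarrow> 'a graph" where
  "clos T r = \<lparr>verts = verts T, edges = {{s, t} |s t. ancestor T r t s}\<rparr>"


section \<open>Branching\<close>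

definition branch_verts :: "'a graph \<Rightarrow> 'a \<Rightarrow> ('a \<Rightarrow> nat) \<Rightarrow> ('a \<times> ('a \<Rightarrow> nat)) set" where
  "branch_verts T r k = (SIGMA s:verts T. \<Pi>\<^sub>E t\<in>root_path T r s. {1..k t})"

definition branch_ancestor ::
    "'a graph \<Rightarrow> 'a \<Rightarrow> ('a \<Rightarrow> nat) \<Rightarrow> 'a \<times> ('a \<Rightarrow> nat) \<Rightarrow> 'a \<times> ('a \<Rightarrow> nat) \<Rightarrow> bool" where
  "branch_ancestor T r k y x \<longleftrightarrow>
     x \<in> branch_verts T r k \<and> y \<in> branch_verts T r k \<and>
     ancestor T r (fst y) (fst x) \<and> snd y = restrict (snd x) (root_path T r (fst y))"

definition branching ::
    "'a graph \<Rightarrow> 'a \<Rightarrow> ('a \<Rightarrow> nat) \<Rightarrow> 'a graph \<Rightarrow> ('a \<times> ('a \<Rightarrow> nat)) graph" where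
  "branching T r k G =
     \<lparr>verts = branch_verts T r k,
      edges = {{x, y} |x y. branch_ancestor T r k y x \<and> {fst x, fst y} \<in> edges G}\<rparr>"


section \<open>Minimum branching core size\<close>

definition colour :: "'a graph \<Rightarrow> 'a graph \<Rightarrow> 'a \<Rightarrow> 'a \<Rightarrow> nat set" where
  "colour H T r s = {level T r t |t. ancestor T r t s \<and> {s, t} \<in> edges H}"

definition colour_automorphisms :: "'a graph \<Rightarrow> 'a graph \<Rightarrow> 'a \<Rightarrow> ('a \<Rightarrow> 'a) set" where
  "colour_automorphisms H T r =
     {f. f permutes verts T \<and> is_graph_iso f T T \<and> f r = r \<and>
         (\<forall>s\<in>verts T. colour H T r (f s) = colour H T r s)}"

definition branching_core_size :: "'a graph \<Rightarrow> 'a graph \<Rightarrow> 'a \<Rightarrow> nat" where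
  "branching_core_size H T r =
     card ((\<lambda>s. {f s |f. f \<in> colour_automorphisms H T r}) ` verts T)"

text \<open>A rooted tree is nonempty, so the infimum is attained for every nonempty simple graph \<open>H\<close>;
  for the graph without vertices it is \<open>\<infinity>\<close>.\<close>

definition min_branching_core_size :: "'a graph \<Rightarrow> enat" where
  "min_branching_core_size H =
     Inf {enat (branching_core_size H T r) |T r.
            rooted_tree T r \<and> verts T = verts H \<and> spanning_subgraph H (clos T r)}"

end

theory Submission
  imports Defs
begin

text \<open>Let \<open>T\<close> realise the branching core size of \<open>H\<close>. The orbits of the colour-preserving automorphisms
  form a rooted tree with \<open>bc(T)\<close> vertices. All vertices in an orbit have the same number of siblings
  in that orbit; with these numbers as multiplicities, and with the edges of \<open>H\<close> projected to the
  orbits, the branching of the orbit tree is isomorphic to \<open>H\<close>: a vertex is sent to its orbit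
  together with the numbers of the vertices on its root path within their sibling classes. As the
  core sizes are bounded, only finitely many pairs of an orbit tree and a projected graph occur.

  For polynomiality, split the homomorphisms from \<open>F\<close> to a branching by their projection \<open>\<sigma>\<close> to the
  tree. If \<open>\<sigma>\<close> maps edges to edges, then the homomorphisms over \<open>\<sigma>\<close> are the assignments of numbers
  in \<open>{1..k\<^sub>t}\<close> to the pairs \<open>(v, t)\<close>, where \<open>t\<close> is on the root path of \<open>\<sigma> v\<close>, that satisfy certain
  equalities between coordinates with the same \<open>t\<close>. Their number is a monomial in \<open>k\<close>.\<close>

section \<open>Paths\<close>

lemma is_path_in_verts: "is_path G u p v \<Longrightarrow> v \<in> verts G"
  unfolding is_path_def using last_in_set by blast

lemma is_path_singleton: "is_path G u [x] v \<longleftrightarrow> u = x \<and> v = x \<and> x \<in> verts G"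
  unfolding is_path_def by auto

lemma is_path_loop: "is_path G u p u \<Longrightarrow> p = [u]"
  unfolding is_path_def by (cases p) (auto split: if_splits dest: last_in_set)

lemma is_path_snoc_iff:
  assumes "p \<noteq> []"
  shows "is_path G u (p @ [y]) v \<longleftrightarrow>
    is_path G u p (last p) \<and> v = y \<and> y \<in> verts G \<and> y \<notin> set p \<and> {last p, y} \<in> edges G"
  using assms unfolding is_path_def by (auto simp: successively_append_iff)

lemma is_path_prefix: "is_path G u (p @ q) v \<Longrightarrow> p \<noteq> [] \<Longrightarrow> is_path G u p (last p)"
  unfolding is_path_def by (auto simp: successively_append_iff)

lemma is_path_rev: "is_path G u p v \<Longrightarrow> is_path G v (rev p) u"
  unfolding is_path_def by (auto simp: hd_rev last_rev insert_commute)

lemma is_path_image: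
  assumes "is_path G u p v" "is_graph_iso f G K"
  shows "is_path K (f u) (map f p) (f v)"
proof -
  have f: "inj_on f (verts G)" "f ` verts G = verts K" "\<And>e. e \<in> edges G \<Longrightarrow> f ` e \<in> edges K"
    using assms(2) unfolding is_graph_iso_def bij_betw_def by auto
  have "successively (\<lambda>x y. {f x, f y} \<in> edges K) p"
    using assms(1) f(3)[of "{_, _}"] unfolding is_path_def
    by (auto elim: successively_mono)
  then show ?thesis
    using assms(1) f(1,2) unfolding is_path_def
    by (auto simp: hd_map last_map distinct_map successively_map intro: inj_on_subset)
qed

section \<open>Parents in rooted trees\<close>

locale rooted =
  fixes T :: "'a graph" and r :: 'a
  assumes rooted: "rooted_tree T r"
begin

abbreviation V :: "'a set" where "V \<equiv> verts T"
abbreviation P :: "'a \<Rightarrow> 'a set" where "P \<equiv> root_path T r"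
abbreviation lev :: "'a \<Rightarrow> nat" where "lev \<equiv> level T r"

text \<open>The list behind \<open>root_path\<close>; its order is what makes the parent of a vertex
  visible.\<close>

definition path :: "'a \<Rightarrow> 'a list" where "path s = (THE p. is_path T r p s)"

text \<open>At the root the value is the unspecified \<open>last []\<close>, hence the assumption
  \<open>s \<noteq> r\<close> in the facts on parents.\<close>

definition par :: "'a \<Rightarrow> 'a" where "par s = last (butlast (path s))"

lemma finite_V: "finite V" and root_V: "r \<in> V"
  using rooted unfolding rooted_tree_def tree_def simple_graph_def finite_graph_def by auto

lemma card_edge: "e \<in> edges T \<Longrightarrow> card e = 2"
  using rooted unfolding rooted_tree_def tree_def simple_graph_def by auto

lemma edge_V: "{x, y} \<in> edges T \<Longrightarrow> x \<in> V \<and> y \<in> V"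
  using rooted unfolding rooted_tree_def tree_def simple_graph_def finite_graph_def
  by (metis doubleton_eq_iff)

lemma is_path_path: "s \<in> V \<Longrightarrow> is_path T r (path s) s"
  unfolding path_def by (rule theI') (use rooted in \<open>simp add: rooted_tree_def tree_def\<close>)

lemma path_eqI: "is_path T r p s \<Longrightarrow> path s = p"
  using is_path_path[of s] is_path_in_verts[of T r p s] rooted
  unfolding rooted_tree_def tree_def by blast

lemma P_path: "P s = set (path s)"
  unfolding root_path_def path_def ..

lemma path_root: "path r = [r]"
  by (rule path_eqI) (simp add: is_path_singleton root_V)

lemma P_root: "P r = {r}"
  by (simp add: P_path path_root)

lemma path_par:
  assumes "s \<in> V" "s \<noteq> r"
  shows "path s = path (par s) @ [s]" and "par s \<in> V" and "s \<notin> P (par s)"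
    and "{par s, s} \<in> edges T"
proof -
  define q where "q = butlast (path s)"
  have p: "is_path T r (path s) s" using assms by (simp add: is_path_path)
  then have ne: "path s \<noteq> []" and "last (path s) = s" and "hd (path s) = r"
    unfolding is_path_def by auto
  then have ps: "path s = q @ [s]"
    unfolding q_def by (metis append_butlast_last_id)
  have qne: "q \<noteq> []" using ps \<open>hd (path s) = r\<close> assms(2) by auto
  have pq: "last q = par s" unfolding par_def q_def ..
  have *: "is_path T r q (par s)" "s \<notin> set q" "{par s, s} \<in> edges T"
    using p qne unfolding ps is_path_snoc_iff[OF qne] pq by auto
  have "path (par s) = q" using * by (intro path_eqI)
  then show "path s = path (par s) @ [s]" "par s \<in> V" "s \<notin> P (par s)" "{par s, s} \<in> edges T"
    using ps * is_path_in_verts by (auto simp: P_path)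
qed

lemmas par_V = path_par(2)

lemma P_par: "s \<in> V \<Longrightarrow> s \<noteq> r \<Longrightarrow> P s = insert s (P (par s))"
  using path_par(1)[of s] by (simp add: P_path)

lemma self_P: "s \<in> V \<Longrightarrow> s \<in> P s"
  using is_path_path[of s] unfolding is_path_def P_path by (metis last_in_set)

lemma P_subset_V: "s \<in> V \<Longrightarrow> P s \<subseteq> V"
  using is_path_path[of s] unfolding is_path_def P_path by auto

lemma finite_P: "finite (P s)"
  by (simp add: P_path)

lemma level_root: "lev r = 0"
  by (simp add: level_def P_root)

lemma level_par: "s \<in> V \<Longrightarrow> s \<noteq> r \<Longrightarrow> lev s = Suc (lev (par s))"
proof -
  assume s: "s \<in> V" "s \<noteq> r"
  have "card (P (par s)) > 0"
    using finite_P self_P[OF par_V[OF s]] by (auto simp: card_gt_0_iff)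
  then show ?thesis using path_par(3)[OF s] by (simp add: level_def P_par[OF s] finite_P)
qed

text \<open>The level drops by one on passing to the parent. By this induction facts are carried
  from the root towards the leaves.\<close>

lemma parent_induct [consumes 1, case_names root step]:
  assumes "s \<in> V" "Q r" "\<And>s. s \<in> V \<Longrightarrow> s \<noteq> r \<Longrightarrow> Q (par s) \<Longrightarrow> Q s"
  shows "Q s"
  using assms(1)
proof (induction "lev s" arbitrary: s rule: less_induct)
  case less
  then show ?case
    using assms(2,3) level_par[of s] par_V[of s] by (cases "s = r") auto
qed

lemma level_less: "s \<in> V \<Longrightarrow> t \<in> P s \<Longrightarrow> t \<noteq> s \<Longrightarrow> lev t < lev s"
proof (induction s rule: parent_induct)
  case root then show ?case by (simp add: P_root)
next
  case (step s)
  then show ?case using P_par[of s] level_par[of s] by (cases "t = par s") auto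
qed

text \<open>Levels grow strictly along a root path. Hence a set of levels, such as a colour,
  determines a set of ancestors.\<close>

lemma inj_on_level: "s \<in> V \<Longrightarrow> inj_on lev (P s)"
proof (induction s rule: parent_induct)
  case root then show ?case by (simp add: P_root)
next
  case (step s)
  have "lev t < lev s" if "t \<in> P (par s)" for t
    using that level_less[of s t] step P_par[of s] path_par(3)[of s] by auto
  then show ?case using step P_par[of s] by fastforce
qed

lemma P_mono: "s \<in> V \<Longrightarrow> t \<in> P s \<Longrightarrow> P t \<subseteq> P s"
proof (induction s rule: parent_induct)
  case root then show ?case by (simp add: P_root)
next
  case (step s) then show ?case using P_par[of s] by auto
qed

lemma par_mem_P: "s \<in> V \<Longrightarrow> s \<noteq> r \<Longrightarrow> par s \<in> P s"
  using P_par self_P par_V by auto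

lemma ancestor_V: "ancestor T r t s \<Longrightarrow> t \<in> V \<and> s \<in> V"
  using P_subset_V unfolding ancestor_def by auto

text \<open>Paths are unique: if \<open>y\<close> is not on the root path of \<open>x\<close>,
  appending \<open>y\<close> to it gives the root path of \<open>y\<close>; if it is, cutting the
  path after \<open>y\<close> and appending \<open>x\<close> gives the root path of \<open>x\<close>
  again.\<close>

lemma edge_par:
  assumes "{x, y} \<in> edges T"
  shows "(y \<noteq> r \<and> x = par y) \<or> (x \<noteq> r \<and> y = par x)"
proof -
  have xy: "x \<in> V" "y \<in> V" "x \<noteq> y" using edge_V[OF assms] card_edge[OF assms] by auto
  have px: "is_path T r (path x) x" using xy is_path_path by auto
  then have lx: "path x \<noteq> []" "last (path x) = x" "hd (path x) = r" unfolding is_path_def by auto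
  show ?thesis
  proof (cases "y \<in> set (path x)")
    case False
    then have "is_path T r (path x @ [y]) y"
      using px lx xy assms by (simp add: is_path_snoc_iff)
    then have "path y = path x @ [y]" by (rule path_eqI)
    moreover have "y \<noteq> r" using False lx hd_in_set[of "path x"] by auto
    ultimately show ?thesis using lx by (simp add: par_def)
  next
    case True
    then obtain q z where q: "path x = (q @ [y]) @ z" by (auto simp: in_set_conv_decomp)
    have "z \<noteq> []" using q lx xy by auto
    then have "x \<notin> set (q @ [y])" using q lx px unfolding is_path_def
      by (metis disjoint_iff distinct_append last_appendR last_in_set)
    moreover have "is_path T r (q @ [y]) y"
      using is_path_prefix[of T r "q @ [y]" z x] px q by simp
    ultimately have "is_path T r ((q @ [y]) @ [x]) x"
      using xy assms is_path_snoc_iff[of "q @ [y]" T r x x] by (simp add: insert_commute)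
    then have "path x = (q @ [y]) @ [x]" by (rule path_eqI)
    moreover from this have "x \<noteq> r" using lx px unfolding is_path_def
      by (cases q) auto
    ultimately show ?thesis by (simp add: par_def butlast_append)
  qed
qed

text \<open>By \<open>edge_par\<close>, if \<open>p s\<close> is not the parent of \<open>s\<close>,
  then \<open>s\<close> is the parent of \<open>p s\<close>. By induction
  \<open>p (p s) = s\<close>, so \<open>l\<close> would decrease twice and be back at its
  start.\<close>

lemma par_eqI:
  assumes parent: "\<And>s. s \<in> V \<Longrightarrow> s \<noteq> r \<Longrightarrow> p s \<in> V \<and> {p s, s} \<in> edges T \<and> l (p s) < (l s :: nat)"
    and "s \<in> V" "s \<noteq> r"
  shows "par s = p s"
  using assms(2,3)
proof (induction "l s" arbitrary: s rule: less_induct)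
  case less
  note p = parent[OF less.prems]
  show ?case
  proof (rule ccontr)
    assume "par s \<noteq> p s"
    then have *: "p s \<noteq> r" "par (p s) = s" using edge_par[of "p s" s] p by auto
    then have "p (p s) = s" using less.hyps[of "p s"] p by auto
    then show False using parent[of "p s"] p * by auto
  qed
qed

text \<open>The image of the root path starts at \<open>f r = r\<close> and is a path again, so
  uniqueness applies.\<close>

lemma automorphism_path:
  assumes "is_graph_iso f T T" "f r = r" "s \<in> V"
  shows "path (f s) = map f (path s)"
  using is_path_image[OF is_path_path[OF assms(3)] assms(1)] assms(2) by (simp add: path_eqI)

lemma automorphism_P: "is_graph_iso f T T \<Longrightarrow> f r = r \<Longrightarrow> s \<in> V \<Longrightarrow> P (f s) = f ` P s"
  by (simp add: P_path automorphism_path)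

lemma automorphism_level:
  assumes "is_graph_iso f T T" "f r = r" "s \<in> V"
  shows "lev (f s) = lev s"
proof -
  have "inj_on f (P s)"
    using assms P_subset_V unfolding is_graph_iso_def bij_betw_def by (meson inj_on_subset)
  then show ?thesis unfolding level_def using assms by (simp add: automorphism_P card_image)
qed

lemma automorphism_par:
  assumes "is_graph_iso f T T" "f r = r" "s \<in> V" "s \<noteq> r"
  shows "par (f s) = f (par s)"
proof -
  have "path (par s) \<noteq> []" "last (path (par s)) = par s"
    using is_path_path[OF par_V[OF assms(3,4)]] unfolding is_path_def by auto
  then show ?thesis
    using automorphism_path[OF assms(1-3)] path_par(1)[OF assms(3,4)]
    by (simp add: par_def[of "f s"] last_map)
qed

end

section \<open>Trees from parent functions\<close>

lemma tree_singleton: "tree \<lparr>verts = {r}, edges = {}\<rparr>"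
proof -
  have "is_path \<lparr>verts = {r}, edges = {}\<rparr> r p r \<longleftrightarrow> p = [r]" for p
    using is_path_loop is_path_singleton by fastforce
  then show ?thesis unfolding tree_def simple_graph_def finite_graph_def by auto
qed

text \<open>A path between old vertices avoids \<open>x\<close>, since both its neighbours on the
  path would have to be \<open>y\<close>. A path from an old vertex to \<open>x\<close> is an old
  path to \<open>y\<close> extended by \<open>x\<close>, and paths from \<open>x\<close> are
  reversals of these.\<close>

lemma tree_insert_leaf:
  assumes T: "tree T" and y: "y \<in> verts T" and x: "x \<notin> verts T"
  shows "tree \<lparr>verts = insert x (verts T), edges = insert {x, y} (edges T)\<rparr>" (is "tree ?T'")
proof -
  have simp: "simple_graph T" and uniq: "\<And>u v. u \<in> verts T \<Longrightarrow> v \<in> verts T \<Longrightarrow> \<exists>!p. is_path T u p v"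
    using T unfolding tree_def by auto
  have edge_verts: "e \<subseteq> verts T" if "e \<in> edges T" for e
    using simp that unfolding simple_graph_def finite_graph_def by auto
  have old: "is_path ?T' u p v \<longleftrightarrow> is_path T u p v" if uv: "u \<in> verts T" "v \<in> verts T" for u v p
  proof
    assume "is_path T u p v"
    then show "is_path ?T' u p v" unfolding is_path_def by (auto elim: successively_mono)
  next
    assume p: "is_path ?T' u p v"
    have nx: "x \<notin> set p"
    proof
      assume "x \<in> set p"
      then obtain a b where ab: "p = a @ x # b" by (auto simp: in_set_conv_decomp)
      have "a \<noteq> []" "b \<noteq> []" using p uv x unfolding is_path_def ab by (auto split: if_splits)
      then obtain a' c d b' where "a = a' @ [c]" "b = d # b'" by (metis list.exhaust rev_exhaust)
      then have "{c, x} \<in> edges ?T'" "{x, d} \<in> edges ?T'" "c \<noteq> d"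
        using p unfolding is_path_def ab by (auto simp: successively_append_iff)
      then show False using x edge_verts by (auto simp: doubleton_eq_iff)
    qed
    then have "successively (\<lambda>a b. {a, b} \<in> edges T) p"
      using p unfolding is_path_def by (auto elim!: successively_mono simp: doubleton_eq_iff)
    then show "is_path T u p v" using p nx unfolding is_path_def by auto
  qed
  have toleaf: "is_path ?T' u p x \<longleftrightarrow> (\<exists>q. p = q @ [x] \<and> is_path T u q y)" if u: "u \<in> verts T" for u p
  proof
    assume p: "is_path ?T' u p x"
    then obtain q where q: "p = q @ [x]" unfolding is_path_def
      by (metis append_butlast_last_id)
    have "q \<noteq> []" using p u x unfolding q is_path_def by auto
    then have *: "is_path ?T' u q (last q)" "{last q, x} \<in> edges ?T'" "x \<notin> set q"
      using p is_path_snoc_iff[of q ?T' u x x] unfolding q by auto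
    then have "last q = y" using x edge_verts \<open>q \<noteq> []\<close> by (auto simp: doubleton_eq_iff)
    then show "\<exists>q. p = q @ [x] \<and> is_path T u q y" using * q old[of u y q] u y by auto
  next
    assume "\<exists>q. p = q @ [x] \<and> is_path T u q y"
    then obtain q where q: "p = q @ [x]" "is_path T u q y" by blast
    then have "q \<noteq> []" "last q = y" "x \<notin> set q" using x unfolding is_path_def by auto
    then show "is_path ?T' u p x"
      using q old[of u y q] u y is_path_snoc_iff[of q ?T' u x x] by (auto simp: insert_commute)
  qed
  have leaf1: "\<exists>!p. is_path ?T' u p x" if "u \<in> verts T" for u
    using uniq[OF that y] unfolding toleaf[OF that] by auto
  have uniq': "\<exists>!p. is_path ?T' u p v" if uv: "u \<in> verts ?T'" "v \<in> verts ?T'" for u v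
  proof -
    consider "u \<in> verts T" "v \<in> verts T" | "u \<in> verts T" "v = x" | "u = x" "v \<in> verts T" | "u = x" "v = x"
      using uv by auto
    then show ?thesis
    proof cases
      case 1 then show ?thesis using old uniq by auto
    next
      case 2 then show ?thesis using leaf1 by auto
    next
      case 3
      then obtain p where p: "is_path ?T' v p x" "\<And>q. is_path ?T' v q x \<Longrightarrow> q = p" using leaf1 by metis
      have "is_path ?T' x (rev p) v" using p(1) by (rule is_path_rev)
      moreover have "q = rev p" if "is_path ?T' x q v" for q
        using p(2)[OF is_path_rev[OF that]] by auto
      ultimately show ?thesis using 3 by metis
    next
      case 4
      have "is_path ?T' x [x] x" by (simp add: is_path_singleton)
      then show ?thesis using 4 is_path_loop by metis
    qed
  qed
  have simp': "simple_graph ?T'"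
  proof -
    have "x \<noteq> y" using x y by auto
    then have "card {x, y} = 2" by simp
    moreover have "\<exists>u\<in>insert x (verts T). \<exists>v\<in>insert x (verts T). e = {u, v}"
      if "e \<in> insert {x, y} (edges T)" for e
    proof (cases "e \<in> edges T")
      case True
      then obtain u v where "u \<in> verts T" "v \<in> verts T" "e = {u, v}"
        using simp unfolding simple_graph_def finite_graph_def by meson
      then show ?thesis by (intro bexI[of _ u] bexI[of _ v]) simp_all
    next
      case False
      then have "e = {x, y}" using that by simp
      then show ?thesis using y by (intro bexI[of _ x] bexI[of _ y]) simp_all
    qed
    ultimately show ?thesis using simp unfolding simple_graph_def finite_graph_def by simp
  qed
  show ?thesis
    unfolding tree_def by (intro conjI ballI simp' uniq') simp_all
qed

definition parent_graph :: "'a set \<Rightarrow> 'a \<Rightarrow> ('a \<Rightarrow> 'a) \<Rightarrow> 'a graph" where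
  "parent_graph A r p = \<lparr>verts = A, edges = (\<lambda>s. {s, p s}) ` (A - {r})\<rparr>"

text \<open>The rank \<open>l\<close> keeps \<open>p\<close> from running in cycles. A vertex other
  than the root with maximal rank is the parent of no vertex, so it can be removed as a
  leaf.\<close>

lemma tree_parent_graph:
  fixes l :: "'a \<Rightarrow> nat"
  assumes "finite A" "r \<in> A" "\<And>s. s \<in> A \<Longrightarrow> s \<noteq> r \<Longrightarrow> p s \<in> A \<and> l (p s) < l s"
  shows "tree (parent_graph A r p)"
  using assms
proof (induction "card A" arbitrary: A rule: less_induct)
  case less
  show ?case
  proof (cases "A = {r}")
    case True then show ?thesis using tree_singleton by (simp add: parent_graph_def)
  next
    case False
    define B where "B = A - {r}"
    have "finite B" "B \<noteq> {}" using False less.prems B_def by auto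
    then have "Max (l ` B) \<in> l ` B" by simp
    then obtain x where x: "x \<in> B" "l x = Max (l ` B)" by auto
    have max: "l s \<le> l x" if "s \<in> B" for s using that x \<open>finite B\<close> by simp
    have xA: "x \<in> A" "x \<noteq> r" using x B_def by auto
    have "tree (parent_graph (A - {x}) r p)"
    proof (rule less.hyps)
      show "card (A - {x}) < card A" using xA less.prems(1) by (meson card_Diff1_less)
      show "p s \<in> A - {x} \<and> l (p s) < l s" if "s \<in> A - {x}" "s \<noteq> r" for s
        using less.prems(3)[of s] that max[of s] B_def by auto
    qed (use less.prems xA in auto)
    moreover have "p x \<noteq> x" using less.prems(3)[of x] xA by auto
    ultimately have "tree \<lparr>verts = insert x (A - {x}), edges = insert {x, p x} ((\<lambda>s. {s, p s}) ` (A - {x} - {r}))\<rparr>"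
      using tree_insert_leaf[of "parent_graph (A - {x}) r p" "p x" x] less.prems(3)[of x] xA
      by (auto simp: parent_graph_def)
    moreover have "insert x (A - {x}) = A" and A: "A - {r} = insert x (A - {x} - {r})" using xA by auto
    moreover have "(\<lambda>s. {s, p s}) ` (A - {r}) = insert {x, p x} ((\<lambda>s. {s, p s}) ` (A - {x} - {r}))"
      by (subst A) (rule image_insert)
    ultimately show ?thesis unfolding parent_graph_def by (simp only:)
  qed
qed

section \<open>The quotient by the colour-preserving automorphisms\<close>

lemma colour_automorphisms_id: "id \<in> colour_automorphisms H T r"
  unfolding colour_automorphisms_def is_graph_iso_def by (auto simp: permutes_id)

lemma colour_automorphisms_comp:
  assumes "f \<in> colour_automorphisms H T r" "g \<in> colour_automorphisms H T r"
  shows "g \<circ> f \<in> colour_automorphisms H T r"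
proof -
  have "(\<lambda>e. (g \<circ> f) ` e) ` edges T = (\<lambda>e. g ` e) ` (\<lambda>e. f ` e) ` edges T"
    by (simp add: image_image image_comp)
  then show ?thesis
    using assms unfolding colour_automorphisms_def is_graph_iso_def
    by (auto simp: permutes_in_image intro: permutes_compose bij_betw_trans)
qed

lemma colour_automorphisms_inv:
  assumes "f \<in> colour_automorphisms H T r"
  shows "inv f \<in> colour_automorphisms H T r"
proof -
  have f: "f permutes verts T" "(\<lambda>e. f ` e) ` edges T = edges T" "f r = r"
    "\<And>s. s \<in> verts T \<Longrightarrow> colour H T r (f s) = colour H T r s"
    using assms unfolding colour_automorphisms_def is_graph_iso_def by auto
  have p: "inv f permutes verts T" using f(1) by (rule permutes_inv)
  have "(\<lambda>e. inv f ` e) ` edges T = (\<lambda>e. inv f ` e) ` (\<lambda>e. f ` e) ` edges T"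
    by (simp only: f(2))
  also have "\<dots> = edges T"
    by (simp add: image_image permutes_inverses(2)[OF f(1)])
  finally have e: "(\<lambda>e. inv f ` e) ` edges T = edges T" .
  moreover have "inv f r = r" using f(1,3) permutes_inv_eq by metis
  moreover have "colour H T r (inv f s) = colour H T r s" if "s \<in> verts T" for s
    using f(4)[of "inv f s"] that by (simp add: permutes_in_image[OF p] permutes_inverses(1)[OF f(1)])
  ultimately show ?thesis
    using p unfolding colour_automorphisms_def is_graph_iso_def by (auto simp: permutes_imp_bij)
qed

lemma ex_bij_betw_finite_atLeast1: "finite A \<Longrightarrow> \<exists>g. bij_betw g A {1..card A}"
  using ex_bij_betw_nat_finite_1 bij_betw_inv by blast

text \<open>Has the form of the sets in \<open>branching_core_size\<close>, so that the core size is
  the number of values of \<open>orbit\<close> on the tree.\<close>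

definition orbit :: "'a graph \<Rightarrow> 'a graph \<Rightarrow> 'a \<Rightarrow> 'a \<Rightarrow> 'a set" where
  "orbit H T r s = {f s |f. f \<in> colour_automorphisms H T r}"

lemma orbit_eq_iff:
  "orbit H T r s = orbit H T r s' \<longleftrightarrow> (\<exists>f\<in>colour_automorphisms H T r. f s = s')"
proof
  assume "orbit H T r s = orbit H T r s'"
  moreover have "s' \<in> orbit H T r s'"
    unfolding orbit_def using colour_automorphisms_id[of H T r] by (auto intro!: exI[of _ id])
  ultimately have "s' \<in> orbit H T r s" by simp
  then show "\<exists>f\<in>colour_automorphisms H T r. f s = s'" unfolding orbit_def by auto
next
  have sub: "orbit H T r (f s) \<subseteq> orbit H T r s" if "f \<in> colour_automorphisms H T r" for f s
  proof
    fix x assume "x \<in> orbit H T r (f s)"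
    then obtain g where "g \<in> colour_automorphisms H T r" "x = (g \<circ> f) s" unfolding orbit_def by auto
    then show "x \<in> orbit H T r s" unfolding orbit_def using colour_automorphisms_comp[OF that] by blast
  qed
  assume "\<exists>f\<in>colour_automorphisms H T r. f s = s'"
  then obtain f where f: "f \<in> colour_automorphisms H T r" "f s = s'" by blast
  have "f permutes verts T" using f(1) unfolding colour_automorphisms_def by auto
  then have "inv f s' = s" using f(2) permutes_inverses(2) by fastforce
  then show "orbit H T r s = orbit H T r s'"
    using sub[OF f(1), of s] sub[OF colour_automorphisms_inv[OF f(1)], of s'] f(2) by auto
qed

text \<open>The map \<pi> stands for any labelling of the orbits. Keeping the labels abstract allows
  the quotient tree to be put on the numbers from 1 to \<open>h\<close> later.\<close>

locale rooted_quotient = rooted T r for T :: "'a graph" and r +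
  fixes H :: "'a graph" and \<pi> :: "'a \<Rightarrow> 'b" and W :: "'b set"
  assumes H_clos: "spanning_subgraph H (clos T r)"
    and \<pi>_W: "\<pi> ` verts T = W"
    and \<pi>_eq_iff: "\<And>s s'. s \<in> verts T \<Longrightarrow> s' \<in> verts T \<Longrightarrow>
      \<pi> s = \<pi> s' \<longleftrightarrow> (\<exists>f\<in>colour_automorphisms H T r. f s = s')"
begin

abbreviation Aut :: "('a \<Rightarrow> 'a) set" where "Aut \<equiv> colour_automorphisms H T r"

lemma Aut_facts:
  assumes "f \<in> Aut"
  shows Aut_iso: "is_graph_iso f T T" and Aut_root: "f r = r" and Aut_inj: "inj f"
    and Aut_V: "s \<in> V \<Longrightarrow> f s \<in> V" and Aut_colour: "s \<in> V \<Longrightarrow> colour H T r (f s) = colour H T r s"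
  using assms unfolding colour_automorphisms_def
  by (auto simp: permutes_in_image permutes_inj)

lemma Aut_par: "f \<in> Aut \<Longrightarrow> s \<in> V \<Longrightarrow> s \<noteq> r \<Longrightarrow> par (f s) = f (par s)"
  by (simp add: automorphism_par Aut_facts)

lemma \<pi>_Aut: "f \<in> Aut \<Longrightarrow> s \<in> V \<Longrightarrow> \<pi> (f s) = \<pi> s"
  using \<pi>_eq_iff[of s "f s"] Aut_V by auto

lemma \<pi>_colour: "s \<in> V \<Longrightarrow> s' \<in> V \<Longrightarrow> \<pi> s = \<pi> s' \<Longrightarrow> colour H T r s = colour H T r s'"
  using \<pi>_eq_iff Aut_colour by auto

lemma \<pi>_level: "s \<in> V \<Longrightarrow> s' \<in> V \<Longrightarrow> \<pi> s = \<pi> s' \<Longrightarrow> lev s = lev s'"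
  using \<pi>_eq_iff[of s s'] automorphism_level Aut_iso Aut_root by metis

text \<open>Orbits stay within one level, and only the root has level 0.\<close>

lemma \<pi>_root: "s \<in> V \<Longrightarrow> \<pi> s = \<pi> r \<longleftrightarrow> s = r"
  using \<pi>_level[OF _ root_V] level_par[of s] level_root by fastforce

lemma \<pi>_par: "s \<in> V \<Longrightarrow> s' \<in> V \<Longrightarrow> s \<noteq> r \<Longrightarrow> \<pi> s = \<pi> s' \<Longrightarrow> \<pi> (par s) = \<pi> (par s')"
  using \<pi>_eq_iff[of s s'] Aut_par \<pi>_Aut par_V by metis

lemma finite_W: "finite W"
  using \<pi>_W finite_V by auto

definition rep :: "'b \<Rightarrow> 'a" where "rep = inv_into V \<pi>"

lemma rep: "o' \<in> W \<Longrightarrow> rep o' \<in> V" "o' \<in> W \<Longrightarrow> \<pi> (rep o') = o'"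
  unfolding rep_def using \<pi>_W by (auto simp: inv_into_into f_inv_into_f)

lemma \<pi>_mem: "s \<in> V \<Longrightarrow> \<pi> s \<in> W"
  using \<pi>_W by auto

text \<open>The choice of the representative has no influence: automorphisms commute with
  \<open>par\<close>, so the parents of the vertices in one orbit lie in one orbit.\<close>

definition qpar :: "'b \<Rightarrow> 'b" where "qpar o' = \<pi> (par (rep o'))"

lemma qpar: "s \<in> V \<Longrightarrow> s \<noteq> r \<Longrightarrow> qpar (\<pi> s) = \<pi> (par s)"
  unfolding qpar_def using rep[OF \<pi>_mem] \<pi>_par by metis

text \<open>Serves as the rank in \<open>tree_parent_graph\<close> and in
  \<open>par_eqI\<close>.\<close>

definition qlevel :: "'b \<Rightarrow> nat" where "qlevel o' = lev (rep o')"

lemma qlevel: "s \<in> V \<Longrightarrow> qlevel (\<pi> s) = lev s"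
  unfolding qlevel_def using rep[OF \<pi>_mem] \<pi>_level by metis

definition qtree :: "'b graph" where "qtree = parent_graph W (\<pi> r) qpar"

lemma qpar_W:
  assumes "o' \<in> W" "o' \<noteq> \<pi> r" shows "qpar o' \<in> W \<and> qlevel (qpar o') < qlevel o'"
proof -
  obtain s where s: "s \<in> V" "o' = \<pi> s" "s \<noteq> r" using assms \<pi>_W by auto
  then show ?thesis using qpar qlevel par_V[of s] level_par[of s] \<pi>_mem by auto
qed

sublocale Q: rooted qtree "\<pi> r"
proof
  show "rooted_tree qtree (\<pi> r)"
    unfolding rooted_tree_def qtree_def
    using tree_parent_graph[of W "\<pi> r" qpar qlevel] finite_W \<pi>_mem root_V qpar_W
    by (simp add: parent_graph_def)
qed

lemma Q_V: "Q.V = W"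
  by (simp add: qtree_def parent_graph_def)

text \<open>The quotient tree is built from \<open>qpar\<close>, while \<open>Q.par\<close> is read
  off its root paths; \<open>par_eqI\<close> identifies the two.\<close>

lemma Q_par: "s \<in> V \<Longrightarrow> s \<noteq> r \<Longrightarrow> Q.par (\<pi> s) = \<pi> (par s)"
proof -
  assume s: "s \<in> V" "s \<noteq> r"
  have "Q.par (\<pi> s) = qpar (\<pi> s)"
  proof (rule Q.par_eqI[where l = qlevel])
    fix o' assume "o' \<in> Q.V" "o' \<noteq> \<pi> r"
    then show "qpar o' \<in> Q.V \<and> {qpar o', o'} \<in> edges qtree \<and> qlevel (qpar o') < qlevel o'"
      using qpar_W[of o'] by (auto simp: qtree_def parent_graph_def insert_commute)
  qed (use s \<pi>_mem \<pi>_root Q_V in auto)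
  then show ?thesis using s qpar by simp
qed

lemma Q_P: "s \<in> V \<Longrightarrow> Q.P (\<pi> s) = \<pi> ` P s"
proof (induction s rule: parent_induct)
  case root then show ?case by (simp add: P_root Q.P_root)
next
  case (step s)
  then show ?case using Q.P_par[of "\<pi> s"] P_par[of s] Q_par[of s] \<pi>_mem \<pi>_root Q_V by auto
qed

text \<open>Vertices in one orbit have the same level, and a root path has only one vertex on each
  level.\<close>

lemma inj_on_\<pi>_P: "s \<in> V \<Longrightarrow> inj_on \<pi> (P s)"
  using inj_on_level[of s] \<pi>_level P_subset_V[of s] unfolding inj_on_def by blast

lemma Q_ancestor: "ancestor T r t s \<Longrightarrow> ancestor qtree (\<pi> r) (\<pi> t) (\<pi> s)"
  unfolding ancestor_def using Q_P \<pi>_mem Q_V inj_on_\<pi>_P[of s] self_P[of s] inj_onD by fastforce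

section \<open>Sibling classes and their numbering\<close>

text \<open>The junk value \<open>par r\<close> does no harm here, because \<open>r\<close> is alone in its fibre.\<close>

definition siblings :: "'a \<Rightarrow> 'a set" where
  "siblings s = {s' \<in> V. \<pi> s' = \<pi> s \<and> par s' = par s}"

lemma finite_siblings: "finite (siblings s)"
  unfolding siblings_def using finite_V by auto

text \<open>An automorphism that takes \<open>s\<close> to \<open>s'\<close> maps the siblings of
  \<open>s\<close> injectively to siblings of \<open>s'\<close>; equality follows by
  symmetry.\<close>

lemma card_siblings_eq:
  assumes "s \<in> V" "s' \<in> V" "\<pi> s = \<pi> s'"
  shows "card (siblings s) = card (siblings s')"
proof -
  have "card (siblings s) \<le> card (siblings s')" if s: "s \<in> V" "s' \<in> V" "\<pi> s = \<pi> s'" for s s'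
  proof -
    obtain f where f: "f \<in> Aut" "f s = s'" using \<pi>_eq_iff s by auto
    have "f ` siblings s \<subseteq> siblings s'"
    proof
      fix y assume "y \<in> f ` siblings s"
      then obtain x where x: "x \<in> V" "\<pi> x = \<pi> s" "par x = par s" "y = f x"
        unfolding siblings_def by auto
      \<comment> \<open>Automorphisms commute with \<open>par\<close> only away from the root; at
        the root \<open>x\<close> and \<open>s\<close> are both \<open>r\<close>.\<close>
      have "par (f x) = par (f s)"
      proof (cases "s = r")
        case True then show ?thesis using x \<pi>_root by auto
      next
        case False then show ?thesis using x \<pi>_root Aut_par[OF f(1)] that by metis
      qed
      then show "y \<in> siblings s'"
        using x f that \<pi>_Aut Aut_V unfolding siblings_def by auto
    qed
    then show ?thesis
      using card_inj_on_le[of f "siblings s" "siblings s'"] Aut_inj[OF f(1)] finite_siblings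
      by (meson inj_on_subset subset_UNIV)
  qed
  then show ?thesis using assms by (metis le_antisym)
qed

text \<open>Restricted to \<open>W\<close> because the elements of \<open>multi_indices\<close> are
  extensional functions.\<close>

definition mult :: "'b \<Rightarrow> nat" where
  "mult = restrict (\<lambda>o'. card (siblings (rep o'))) W"

lemma mult: "s \<in> V \<Longrightarrow> mult (\<pi> s) = card (siblings s)"
  using \<pi>_mem[of s] rep[of "\<pi> s"] card_siblings_eq[of "rep (\<pi> s)" s] by (simp add: mult_def)

lemma mult_PiE: "mult \<in> W \<rightarrow>\<^sub>E {1..}"
proof -
  have "card (siblings s) \<ge> 1" if "s \<in> V" for s
  proof -
    have "s \<in> siblings s" using that unfolding siblings_def by auto
    then show ?thesis using finite_siblings[of s] by (simp add: Suc_le_eq card_gt_0_iff) blast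
  qed
  then show ?thesis unfolding mult_def using rep by auto
qed

text \<open>The choice depends on \<open>s\<close> only through the set \<open>siblings s\<close>,
  so one bijection numbers the whole class.\<close>

definition num :: "'a \<Rightarrow> nat" where
  "num s = (SOME g. bij_betw g (siblings s) {1..card (siblings s)}) s"

lemma bij_num: "s \<in> V \<Longrightarrow> bij_betw num (siblings s) {1..mult (\<pi> s)}"
proof -
  assume s: "s \<in> V"
  define g where "g = (SOME g. bij_betw g (siblings s) {1..card (siblings s)})"
  have g: "bij_betw g (siblings s) {1..card (siblings s)}"
    unfolding g_def by (rule someI_ex[where P = "\<lambda>g. bij_betw g _ _"]) (rule ex_bij_betw_finite_atLeast1[OF finite_siblings])
  have "siblings s' = siblings s" if "s' \<in> siblings s" for s'
    using that unfolding siblings_def by auto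
  then have "num s' = g s'" if "s' \<in> siblings s" for s'
    using that unfolding num_def g_def by auto
  then have "bij_betw num (siblings s) {1..card (siblings s)}"
    using g by (simp cong: bij_betw_cong)
  then show ?thesis using mult[OF s] by simp
qed

lemma num_mem: "s \<in> V \<Longrightarrow> num s \<in> {1..mult (\<pi> s)}"
  using bij_betwE[OF bij_num[of s]] unfolding siblings_def by auto

text \<open>The coordinate at an orbit is the number of the vertex of \<open>P s\<close> in this
  orbit, which is unique by \<open>inj_on_\<pi>_P\<close>.\<close>

definition addr :: "'a \<Rightarrow> 'b \<Rightarrow> nat" where
  "addr s = restrict (\<lambda>o'. num (inv_into (P s) \<pi> o')) (\<pi> ` P s)"

definition \<Phi> :: "'a \<Rightarrow> 'b \<times> ('b \<Rightarrow> nat)" where "\<Phi> s = (\<pi> s, addr s)"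

lemma addr: "s \<in> V \<Longrightarrow> t \<in> P s \<Longrightarrow> addr s (\<pi> t) = num t"
  unfolding addr_def using inj_on_\<pi>_P[of s] by simp

lemma addr_PiE: "s \<in> V \<Longrightarrow> addr s \<in> (\<Pi>\<^sub>E o'\<in>\<pi> ` P s. {1..mult o'})"
proof (rule PiE_I)
  fix o' assume s: "s \<in> V" "o' \<in> \<pi> ` P s"
  then show "addr s o' \<in> {1..mult o'}" using addr P_subset_V num_mem by fastforce
qed (simp add: addr_def)

text \<open>The number of a vertex does not depend on the root path through which it is reached. The
  equation is the condition on second components in \<open>branch_ancestor\<close>.\<close>

lemma addr_restrict: "s \<in> V \<Longrightarrow> t \<in> P s \<Longrightarrow> addr t = restrict (addr s) (\<pi> ` P t)"
proof
  fix o' assume s: "s \<in> V" "t \<in> P s"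
  then have t: "t \<in> V" using P_subset_V by auto
  show "addr t o' = restrict (addr s) (\<pi> ` P t) o'"
  proof (cases "o' \<in> \<pi> ` P t")
    case True
    then obtain u where "u \<in> P t" "o' = \<pi> u" by auto
    then show ?thesis using True addr[OF s(1)] addr[OF t] P_mono[OF s] by auto
  qed (simp add: addr_def)
qed

lemma \<Phi>_mem: "s \<in> V \<Longrightarrow> \<Phi> s \<in> branch_verts qtree (\<pi> r) mult"
  unfolding branch_verts_def \<Phi>_def using addr_PiE[of s] Q_P[of s] \<pi>_mem Q_V by auto

text \<open>Equal addresses restrict to equal addresses of the parents, which coincide by induction.
  Then \<open>s\<close> and \<open>s'\<close> are siblings with the same number.\<close>

lemma inj_\<Phi>: "s \<in> V \<Longrightarrow> s' \<in> V \<Longrightarrow> \<Phi> s = \<Phi> s' \<Longrightarrow> s = s'"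
proof (induction s arbitrary: s' rule: parent_induct)
  case root then show ?case using \<pi>_root by (auto simp: \<Phi>_def)
next
  case (step s)
  have eq: "\<pi> s = \<pi> s'" "addr s = addr s'" using step by (auto simp: \<Phi>_def)
  then have s': "s' \<noteq> r" using step \<pi>_root by metis
  have pp: "\<pi> (par s) = \<pi> (par s')" by (rule \<pi>_par) (use step eq in simp_all)
  have "\<pi> ` P (par s) = \<pi> ` P (par s')"
    using Q_P[of "par s"] Q_P[of "par s'"] pp par_V step s' by metis
  then have "addr (par s) = addr (par s')"
    using addr_restrict[of s "par s"] addr_restrict[of s' "par s'"] par_mem_P step s' eq by metis
  then have "par s = par s'" using step.IH[of "par s'"] par_V[of s'] step.prems s' pp by (simp add: \<Phi>_def)
  then have "s' \<in> siblings s" "s \<in> siblings s" unfolding siblings_def using step eq by auto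
  moreover have "num s = num s'"
    using addr[of s s] addr[of s' s'] self_P step eq by metis
  ultimately show ?case
    using bij_num[of s] step unfolding bij_betw_def inj_on_def by blast
qed

text \<open>By induction the truncated address belongs to some \<open>p\<close> in the orbit of
  \<open>par s\<close>. An automorphism taking \<open>par s\<close> to \<open>p\<close> takes
  \<open>s\<close> to a child \<open>c\<close> of \<open>p\<close>, and one of the siblings of
  \<open>c\<close> has the number that \<open>\<phi>\<close> prescribes.\<close>

lemma surj_\<Phi>:
  "s \<in> V \<Longrightarrow> \<phi> \<in> (\<Pi>\<^sub>E o'\<in>\<pi> ` P s. {1..mult o'}) \<Longrightarrow> \<exists>s'\<in>V. \<Phi> s' = (\<pi> s, \<phi>)"
proof (induction s arbitrary: \<phi> rule: parent_induct)
  case root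
  have "siblings r = {r}" unfolding siblings_def using root_V \<pi>_root by auto
  then have one: "mult (\<pi> r) = 1" using mult root_V by auto
  have "addr r \<in> (\<Pi>\<^sub>E o'\<in>\<pi> ` P r. {1..mult o'})" using addr_PiE root_V by auto
  \<comment> \<open>The root has multiplicity 1, so both functions take the only possible value 1 at
    its orbit.\<close>
  then have "addr r = \<phi>"
    using root one by (auto simp: P_root PiE_iff intro!: extensionalityI)
  then show ?case using root_V by (auto simp: \<Phi>_def)
next
  case (step s)
  define \<psi> where "\<psi> = restrict \<phi> (\<pi> ` P (par s))"
  have P: "\<pi> ` P s = insert (\<pi> s) (\<pi> ` P (par s))" using P_par step by auto
  have "\<psi> \<in> (\<Pi>\<^sub>E o'\<in>\<pi> ` P (par s). {1..mult o'})"
    unfolding \<psi>_def using step.prems P by (auto simp: PiE_iff)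
  then obtain p where p: "p \<in> V" "\<pi> p = \<pi> (par s)" "addr p = \<psi>"
    using step.IH[of \<psi>] unfolding \<Phi>_def by blast
  obtain f where f: "f \<in> Aut" "f (par s) = p"
    using p \<pi>_eq_iff[of "par s" p] par_V step by auto
  define c where "c = f s"
  have c: "c \<in> V" "\<pi> c = \<pi> s" "par c = p"
    using f step Aut_V \<pi>_Aut Aut_par unfolding c_def by auto
  have "\<phi> (\<pi> s) \<in> {1..mult (\<pi> c)}" using step.prems P c by (auto simp: PiE_iff)
  then obtain d where d: "d \<in> siblings c" "num d = \<phi> (\<pi> s)"
    using bij_num[OF c(1)] unfolding bij_betw_def by (metis imageE)
  then have d': "d \<in> V" "\<pi> d = \<pi> s" "par d = p" using c unfolding siblings_def by auto
  have dr: "d \<noteq> r" using d' step \<pi>_root by metis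
  have Pd: "P d = insert d (P p)" using P_par[of d] d' dr by auto
  have Pp: "\<pi> ` P p = \<pi> ` P (par s)" using Q_P[of p] Q_P[of "par s"] p par_V step by metis
  have "addr d = \<phi>"
  proof (rule extensionalityI)
    show "addr d \<in> extensional (\<pi> ` P s)" unfolding addr_def P Pd using Pp d' by auto
    show "\<phi> \<in> extensional (\<pi> ` P s)" using step.prems by (simp add: PiE_def)
    fix o' assume o': "o' \<in> \<pi> ` P s"
    show "addr d o' = \<phi> o'"
    proof (cases "o' \<in> \<pi> ` P p")
      case True
      have "addr p o' = addr d o'" using addr_restrict[of d p] d' Pd self_P[of p] p True by auto
      moreover have "addr p o' = \<phi> o'" using p True unfolding \<psi>_def Pp by auto
      ultimately show ?thesis by simp
    next
      case False
      then have "o' = \<pi> s" using o' P Pp by auto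
      then show ?thesis using addr[of d d] self_P[of d] d d' by auto
    qed
  qed
  then show ?case using d' by (auto simp: \<Phi>_def)
qed

lemma bij_\<Phi>: "bij_betw \<Phi> V (branch_verts qtree (\<pi> r) mult)"
proof -
  have "\<exists>s\<in>V. x = \<Phi> s" if xb: "x \<in> branch_verts qtree (\<pi> r) mult" for x
  proof -
    obtain o' \<phi> where x: "x = (o', \<phi>)" "o' \<in> W" "\<phi> \<in> (\<Pi>\<^sub>E t\<in>Q.P o'. {1..mult t})"
      using xb unfolding branch_verts_def Q_V by auto
    obtain s where s: "s \<in> V" "o' = \<pi> s" using x \<pi>_W by auto
    then have "\<phi> \<in> (\<Pi>\<^sub>E t\<in>\<pi> ` P s. {1..mult t})" using x Q_P[of s] by simp
    then show ?thesis using surj_\<Phi>[of s \<phi>] x s by metis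
  qed
  then show ?thesis unfolding bij_betw_def inj_on_def using inj_\<Phi> \<Phi>_mem by blast
qed

section \<open>The projected graph and the isomorphism with the branching\<close>

definition qgraph :: "'b graph" where
  "qgraph = \<lparr>verts = W, edges = {{\<pi> s, \<pi> t} |s t. ancestor T r t s \<and> {s, t} \<in> edges H}\<rparr>"

lemma spanning_qgraph: "spanning_subgraph qgraph (clos qtree (\<pi> r))"
  unfolding spanning_subgraph_def qgraph_def clos_def using Q_V by (auto dest: Q_ancestor)

lemma H_edge: "e \<in> edges H \<Longrightarrow> \<exists>s t. e = {s, t} \<and> ancestor T r t s"
  using H_clos unfolding spanning_subgraph_def clos_def by auto

text \<open>This is where the colours enter. An edge of the projection comes from an edge between
  some \<open>s'\<close> and \<open>t'\<close> in the same orbits. As \<open>s\<close> and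
  \<open>s'\<close> have the same colour, \<open>s\<close> is adjacent to an ancestor on the level
  of \<open>t'\<close>, which is the level of \<open>t\<close>, and \<open>t\<close> is the only
  ancestor there.\<close>

lemma qgraph_edge_iff:
  assumes "ancestor T r t s"
  shows "{\<pi> s, \<pi> t} \<in> edges qgraph \<longleftrightarrow> {s, t} \<in> edges H"
proof
  assume "{s, t} \<in> edges H"
  then show "{\<pi> s, \<pi> t} \<in> edges qgraph" unfolding qgraph_def using assms by auto
next
  assume "{\<pi> s, \<pi> t} \<in> edges qgraph"
  then obtain s' t' where st: "{\<pi> s, \<pi> t} = {\<pi> s', \<pi> t'}" "ancestor T r t' s'" "{s', t'} \<in> edges H"
    unfolding qgraph_def by auto
  have V: "s \<in> V" "t \<in> V" "s' \<in> V" "t' \<in> V" using assms st ancestor_V by auto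
  \<comment> \<open>The levels exclude the crossed matching of the two unordered pairs.\<close>
  have "lev t < lev s" "lev t' < lev s'"
    using assms st level_less unfolding ancestor_def by auto
  then have eq: "\<pi> s = \<pi> s'" "\<pi> t = \<pi> t'"
    using st(1) \<pi>_level V unfolding doubleton_eq_iff by (metis order.asym)+
  have "lev t' \<in> colour H T r s'" unfolding colour_def using st by auto
  then have "lev t \<in> colour H T r s" using eq V \<pi>_colour \<pi>_level by metis
  then obtain u where u: "ancestor T r u s" "{s, u} \<in> edges H" "lev t = lev u"
    unfolding colour_def by auto
  then have "u = t" using inj_on_level[of s] assms unfolding ancestor_def inj_on_def by auto
  then show "{s, t} \<in> edges H" using u by simp
qed

text \<open>The orbit in \<open>y\<close> is that of a vertex \<open>t\<close> on the root path of
  \<open>s\<close>, and by \<open>addr_restrict\<close> the truncated address is the address of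
  \<open>t\<close>.\<close>

lemma branch_ancestor_\<Phi>:
  assumes "s \<in> V"
  shows "branch_ancestor qtree (\<pi> r) mult y (\<Phi> s) \<longleftrightarrow> (\<exists>t. ancestor T r t s \<and> y = \<Phi> t)"
proof
  assume y: "branch_ancestor qtree (\<pi> r) mult y (\<Phi> s)"
  then have a: "fst y \<in> Q.P (\<pi> s)" "fst y \<noteq> \<pi> s" "snd y = restrict (addr s) (Q.P (fst y))"
    unfolding branch_ancestor_def ancestor_def \<Phi>_def by auto
  then obtain t where t: "t \<in> P s" "fst y = \<pi> t" using Q_P[OF assms] by auto
  have "t \<in> V" using t P_subset_V assms by auto
  then have "snd y = addr t" using a t Q_P[of t] addr_restrict[OF assms t(1)] by simp
  then show "\<exists>t. ancestor T r t s \<and> y = \<Phi> t"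
    using t a assms unfolding ancestor_def \<Phi>_def by (metis prod.collapse)
next
  assume "\<exists>t. ancestor T r t s \<and> y = \<Phi> t"
  then obtain t where t: "ancestor T r t s" "y = \<Phi> t" by blast
  then have "t \<in> V" "t \<in> P s" using ancestor_V unfolding ancestor_def by auto
  then show "branch_ancestor qtree (\<pi> r) mult y (\<Phi> s)"
    unfolding branch_ancestor_def
    using t Q_ancestor[OF t(1)] \<Phi>_mem[of t] \<Phi>_mem[OF assms] addr_restrict[OF assms] Q_P[of t]
    by (simp add: \<Phi>_def)
qed

text \<open>The bijection \<open>\<Phi>\<close> matches the two ancestor relations, and for an
  ancestor pair \<open>qgraph_edge_iff\<close> matches adjacency.\<close>

lemma graph_iso_branching: "H \<simeq>\<^sub>g branching qtree (\<pi> r) mult qgraph"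
proof -
  let ?E = "edges (branching qtree (\<pi> r) mult qgraph)"
  have "\<Phi> ` e \<in> ?E" if e: "e \<in> edges H" for e
  proof -
    obtain s t where st: "e = {s, t}" "ancestor T r t s" using H_edge e by blast
    then have "{\<pi> s, \<pi> t} \<in> edges qgraph" using qgraph_edge_iff e by auto
    moreover have "branch_ancestor qtree (\<pi> r) mult (\<Phi> t) (\<Phi> s)"
      using branch_ancestor_\<Phi> st ancestor_V by blast
    ultimately show ?thesis unfolding branching_def st(1)
      by (auto simp: \<Phi>_def intro!: exI[of _ "\<Phi> s"] exI[of _ "\<Phi> t"])
  qed
  moreover have "e \<in> (\<lambda>e. \<Phi> ` e) ` edges H" if e: "e \<in> ?E" for e
  proof -
    obtain x y where xy: "e = {x, y}" "branch_ancestor qtree (\<pi> r) mult y x" "{fst x, fst y} \<in> edges qgraph"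
      using e unfolding branching_def by auto
    then have "x \<in> branch_verts qtree (\<pi> r) mult" unfolding branch_ancestor_def by auto
    then obtain s where s: "s \<in> V" "x = \<Phi> s" using bij_\<Phi> unfolding bij_betw_def by auto
    then obtain t where t: "ancestor T r t s" "y = \<Phi> t" using branch_ancestor_\<Phi> xy by auto
    then have "{s, t} \<in> edges H" using qgraph_edge_iff xy s by (auto simp: \<Phi>_def)
    moreover have "e = \<Phi> ` {s, t}" using xy s t by simp
    ultimately show ?thesis by blast
  qed
  ultimately have "(\<lambda>e. \<Phi> ` e) ` edges H = ?E" by blast
  moreover have "verts H = V" using H_clos unfolding spanning_subgraph_def clos_def by simp
  ultimately have "is_graph_iso \<Phi> H (branching qtree (\<pi> r) mult qgraph)"
    using bij_\<Phi> unfolding is_graph_iso_def by (simp add: branching_def)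
  then show ?thesis unfolding graph_iso_def by blast
qed

end

section \<open>The branching core on an initial segment of the numbers\<close>

lemma graph_iso_branching_core:
  assumes "min_branching_core_size H \<le> enat B"
  obtains h k and T :: "nat graph" and r G where
    "1 \<le> h" "h \<le> B" "k \<in> multi_indices h" "rooted_tree T r" "verts T = {1..h}"
    "spanning_subgraph G (clos T r)" "H \<simeq>\<^sub>g branching T r k G"
proof -
  let ?S = "{enat (branching_core_size H T r) |T r.
    rooted_tree T r \<and> verts T = verts H \<and> spanning_subgraph H (clos T r)}"
  \<comment> \<open>The bound excludes the empty set, whose infimum is \<infinity>; a nonempty set
    in \<open>enat\<close> attains its infimum.\<close>
  have "?S \<noteq> {}"
  proof
    assume e: "?S = {}"
    have "Inf ?S = \<infinity>" unfolding e by (simp add: Inf_enat_def)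
    then show False using assms unfolding min_branching_core_size_def by simp
  qed
  then have "Inf ?S \<in> ?S" by (rule wellorder_InfI[OF ex_in_conv[THEN iffD2, THEN someI_ex]])
  then obtain T r where T: "rooted_tree T r" "spanning_subgraph H (clos T r)"
    and B: "branching_core_size H T r \<le> B"
    using assms unfolding min_branching_core_size_def by auto
  interpret rooted T r using T by unfold_locales
  define h where "h = branching_core_size H T r"
  have h: "h = card (orbit H T r ` V)" unfolding h_def branching_core_size_def orbit_def by simp
  have fin: "finite (orbit H T r ` V)" using finite_V by auto
  \<comment> \<open>Numbering the orbits puts the quotient trees of all graphs on subsets of one
    finite set.\<close>
  obtain g where g: "bij_betw g (orbit H T r ` V) {1..h}"
    using ex_bij_betw_finite_atLeast1[OF fin] unfolding h by blast
  interpret rooted_quotient T r H "g \<circ> orbit H T r" "{1..h}"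
  proof
    show "(g \<circ> orbit H T r) ` V = {1..h}" using g unfolding bij_betw_def by (simp add: image_comp)
    show "(g \<circ> orbit H T r) s = (g \<circ> orbit H T r) s' \<longleftrightarrow> (\<exists>f\<in>colour_automorphisms H T r. f s = s')"
      if "s \<in> V" "s' \<in> V" for s s'
      using g that unfolding orbit_eq_iff[symmetric] bij_betw_def by (auto dest: inj_onD)
  qed (use T in auto)
  show ?thesis
  proof (rule that[OF _ _ _ Q.rooted _ spanning_qgraph graph_iso_branching])
    show "1 \<le> h" using root_V fin unfolding h by (simp add: Suc_le_eq card_gt_0_iff) blast
    show "h \<le> B" using B h_def by simp
  qed (use mult_PiE Q_V in \<open>auto simp: multi_indices_def\<close>)
qed

section \<open>Homomorphisms into branchings\<close>

lemma polynomial_in_monomial: "polynomial_in h (\<lambda>x. \<Prod>i=1..h. x i ^ m i)"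
  unfolding polynomial_in_def by (rule exI[of _ "{m}"], rule exI[of _ "\<lambda>_. 1"]) simp

lemma polynomial_in_zero: "polynomial_in h (\<lambda>x. 0)"
  unfolding polynomial_in_def by (rule exI[of _ "{}"]) simp

text \<open>The sets of exponent vectors may overlap, so both sums are taken over their union, with
  coefficients extended by 0.\<close>

lemma polynomial_in_add:
  assumes "polynomial_in h p" "polynomial_in h q"
  shows "polynomial_in h (\<lambda>x. p x + q x)"
proof -
  obtain M c where M: "finite M" "\<And>x. p x = (\<Sum>m\<in>M. c m * (\<Prod>i=1..h. x i ^ m i))"
    using assms(1) unfolding polynomial_in_def by blast
  obtain N d where N: "finite N" "\<And>x. q x = (\<Sum>m\<in>N. d m * (\<Prod>i=1..h. x i ^ m i))"
    using assms(2) unfolding polynomial_in_def by blast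
  let ?c = "\<lambda>m. if m \<in> M then c m else 0" and ?d = "\<lambda>m. if m \<in> N then d m else 0"
  have "p x + q x = (\<Sum>m\<in>M \<union> N. (?c m + ?d m) * (\<Prod>i=1..h. x i ^ m i))" for x
  proof -
    have "p x = (\<Sum>m\<in>M \<union> N. ?c m * (\<Prod>i=1..h. x i ^ m i))"
      unfolding M(2) using M(1) N(1) by (intro sum.mono_neutral_cong_left) auto
    moreover have "q x = (\<Sum>m\<in>M \<union> N. ?d m * (\<Prod>i=1..h. x i ^ m i))"
      unfolding N(2) using M(1) N(1) by (intro sum.mono_neutral_cong_left) auto
    ultimately show ?thesis by (simp only: distrib_right sum.distrib)
  qed
  then show ?thesis using M(1) N(1) unfolding polynomial_in_def
    by (intro exI[of _ "M \<union> N"] exI[of _ "\<lambda>m. ?c m + ?d m"]) simp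
qed

lemma polynomial_in_sum:
  assumes "finite A" "\<And>a. a \<in> A \<Longrightarrow> polynomial_in h (p a)"
  shows "polynomial_in h (\<lambda>x. \<Sum>a\<in>A. p a x)"
  using assms by (induction A rule: finite_induct) (auto simp: polynomial_in_zero intro: polynomial_in_add)

text \<open>Factors are grouped by variable; the exponent of \<open>x i\<close> is the size of the
  fibre of \<kappa> over \<open>i\<close>.\<close>

lemma polynomial_in_prod_vars:
  assumes "finite E" "\<kappa> ` E \<subseteq> {1..h}"
  shows "polynomial_in h (\<lambda>x. \<Prod>e\<in>E. x (\<kappa> e))"
proof -
  have "(\<Prod>e\<in>E. x (\<kappa> e)) = (\<Prod>i=1..h. x i ^ card {e \<in> E. \<kappa> e = i})" for x :: "nat \<Rightarrow> rat"
    by (subst prod.group[OF assms(1) _ assms(2), symmetric]) simp_all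
  then show ?thesis using polynomial_in_monomial by simp
qed

text \<open>Functions subject to equalities between their values are free on a system of
  representatives of the generated equivalence relation.\<close>

lemma card_PiE_equalities:
  fixes \<kappa> :: "'d \<Rightarrow> 'c"
  assumes "finite D" "R \<subseteq> D \<times> D" "\<And>d d'. (d, d') \<in> R \<Longrightarrow> \<kappa> d = \<kappa> d'"
  obtains E where "E \<subseteq> D" "\<And>k :: 'c \<Rightarrow> nat.
    card {\<phi> \<in> (\<Pi>\<^sub>E d\<in>D. {1..k (\<kappa> d)}). \<forall>(d, d')\<in>R. \<phi> d = \<phi> d'} = (\<Prod>e\<in>E. k (\<kappa> e))"
proof -
  define S where "S = (R \<union> R\<inverse>)\<^sup>*"
  have sym: "(b, a) \<in> S" if "(a, b) \<in> S" for a b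
  proof -
    have "sym S" unfolding S_def by (intro sym_rtrancl sym_Un_converse)
    then show ?thesis using that by (meson symD)
  qed
  have trans: "(a, c) \<in> S" if "(a, b) \<in> S" "(b, c) \<in> S" for a b c
    using that unfolding S_def by (rule rtrancl_trans)
  define rep where "rep d = (SOME e. (d, e) \<in> S)" for d
  have rep: "(d, rep d) \<in> S" for d
    unfolding rep_def by (rule someI[of _ d]) (simp add: S_def)
  \<comment> \<open>The type of the values is left general because this is applied both to \<kappa>
    and to the functions that are counted.\<close>
  have inv: "g a = g b" if "(a, b) \<in> S" "\<And>d d'. (d, d') \<in> R \<Longrightarrow> g d = g d'" for a b and g :: "'d \<Rightarrow> 'z"
    using that(1) unfolding S_def by (induction rule: rtrancl_induct) (auto dest: that(2))
  \<comment> \<open>Equivalent elements have the same set of candidates, so \<open>SOME\<close>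
    picks the same one.\<close>
  have repeq: "rep a = rep b" if "(a, b) \<in> S" for a b
    unfolding rep_def using that sym trans by metis
  have S_D: "b \<in> D" if "(a, b) \<in> S" "a \<in> D" for a b
    using that assms(2) unfolding S_def by (induction rule: rtrancl_induct) auto
  have repD: "rep d \<in> D" if "d \<in> D" for d using S_D rep that by blast
  have rep\<kappa>: "\<kappa> (rep d) = \<kappa> d" for d using inv[OF rep[of d], of \<kappa>] assms(3) by auto
  have reprep: "rep (rep d) = rep d" for d using repeq[OF rep[of d]] by simp
  show ?thesis
  proof (rule that[of "rep ` D"])
    show "rep ` D \<subseteq> D" using repD by auto
    fix k :: "'c \<Rightarrow> nat"
    let ?A = "{\<phi> \<in> (\<Pi>\<^sub>E d\<in>D. {1..k (\<kappa> d)}). \<forall>(d, d')\<in>R. \<phi> d = \<phi> d'}"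
    let ?B = "\<Pi>\<^sub>E e\<in>rep ` D. {1..k (\<kappa> e)}"
    have "bij_betw (\<lambda>\<phi>. restrict \<phi> (rep ` D)) ?A ?B"
    proof (rule bij_betw_byWitness[where f' = "\<lambda>\<psi>. \<lambda>d\<in>D. \<psi> (rep d)"])
      show "\<forall>\<phi>\<in>?A. (\<lambda>d\<in>D. restrict \<phi> (rep ` D) (rep d)) = \<phi>"
      proof
        fix \<phi> assume \<phi>: "\<phi> \<in> ?A"
        have "\<phi> (rep d) = \<phi> d" for d using inv[OF rep[of d], of \<phi>] \<phi> by fastforce
        moreover have "\<phi> \<in> extensional D" using \<phi> by (simp add: PiE_def)
        ultimately show "(\<lambda>d\<in>D. restrict \<phi> (rep ` D) (rep d)) = \<phi>"
          by (intro extensionalityI[of _ D]) auto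
      qed
      show "\<forall>\<psi>\<in>?B. restrict (\<lambda>d\<in>D. \<psi> (rep d)) (rep ` D) = \<psi>"
      proof
        fix \<psi> assume "\<psi> \<in> ?B"
        then have "\<psi> \<in> extensional (rep ` D)" by (simp add: PiE_def)
        then show "restrict (\<lambda>d\<in>D. \<psi> (rep d)) (rep ` D) = \<psi>"
          by (intro extensionalityI[of _ "rep ` D"]) (auto simp: repD reprep)
      qed
      show "(\<lambda>\<phi>. restrict \<phi> (rep ` D)) ` ?A \<subseteq> ?B" using repD by (auto simp: PiE_iff)
      have "\<psi> (rep d) \<in> {1..k (\<kappa> d)}" if "\<psi> \<in> ?B" "d \<in> D" for \<psi> d
        using PiE_mem[OF that(1), of "rep d"] that(2) rep\<kappa>[of d] by simp
      moreover have "rep d = rep d'" "d \<in> D" "d' \<in> D" if "(d, d') \<in> R" for d d'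
        using repeq[of d d'] that assms(2) unfolding S_def by auto
      ultimately show "(\<lambda>\<psi>. \<lambda>d\<in>D. \<psi> (rep d)) ` ?B \<subseteq> ?A" by (fastforce intro!: PiE_I)
    qed
    then have "card ?A = card ?B" by (rule bij_betw_same_card)
    then show "card ?A = (\<Prod>e\<in>rep ` D. k (\<kappa> e))" using assms(1) by (simp add: card_PiE)
  qed
qed

section \<open>Counting the homomorphisms over a fixed projection\<close>

locale branching_target = rooted T r for T :: "'a graph" and r +
  fixes G :: "'a graph"
  assumes G_clos: "spanning_subgraph G (clos T r)"
begin

lemma finite_branch_verts: "finite (branch_verts T r k)"
  unfolding branch_verts_def using finite_V finite_P by (auto intro!: finite_PiE)

lemma G_edge_cases:
  assumes "{a, b} \<in> edges G"
  obtains "ancestor T r b a" | "ancestor T r a b"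
proof -
  obtain s t where "{a, b} = {s, t}" "ancestor T r t s"
    using assms G_clos unfolding spanning_subgraph_def clos_def by auto
  then show ?thesis using that by (auto simp: doubleton_eq_iff)
qed

lemma ancestor_asym: "ancestor T r t s \<Longrightarrow> \<not> ancestor T r s t"
  using level_less ancestor_V unfolding ancestor_def by (metis order.asym)

text \<open>The root path of the upper end is contained in that of the lower end, so being its
  restriction means agreement on the intersection. This form is symmetric, as required for unordered
  edges of which either end may be the ancestor.\<close>

lemma branching_edge_iff:
  assumes x: "x \<in> branch_verts T r k" and y: "y \<in> branch_verts T r k" and G: "{fst x, fst y} \<in> edges G"
  shows "{x, y} \<in> edges (branching T r k G) \<longleftrightarrow> (\<forall>t\<in>P (fst x) \<inter> P (fst y). snd x t = snd y t)"
proof -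
  have *: "{x, y} \<in> edges (branching T r k G) \<longleftrightarrow> (\<forall>t\<in>P (fst x) \<inter> P (fst y). snd x t = snd y t)"
    if x: "x \<in> branch_verts T r k" and y: "y \<in> branch_verts T r k" and G: "{fst x, fst y} \<in> edges G"
      and anc: "ancestor T r (fst y) (fst x)" for x y
  proof -
    have sub: "P (fst y) \<subseteq> P (fst x)" using anc P_mono unfolding ancestor_def by auto
    have "{x, y} \<in> edges (branching T r k G) \<longleftrightarrow> branch_ancestor T r k y x"
    proof
      assume "{x, y} \<in> edges (branching T r k G)"
      then obtain x' y' where xy': "{x, y} = {x', y'}" "branch_ancestor T r k y' x'"
        unfolding branching_def by auto
      \<comment> \<open>The reversed matching would make each end an ancestor of the other.\<close>
      then have "x = x' \<and> y = y'"
        using ancestor_asym[OF anc] unfolding branch_ancestor_def doubleton_eq_iff by auto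
      then show "branch_ancestor T r k y x" using xy' by simp
    next
      assume a: "branch_ancestor T r k y x"
      show "{x, y} \<in> edges (branching T r k G)"
        unfolding branching_def graph.select_convs mem_Collect_eq
        by (intro exI[of _ x] exI[of _ y] conjI refl a G)
    qed
    also have "\<dots> \<longleftrightarrow> snd y = restrict (snd x) (P (fst y))"
      using x y anc unfolding branch_ancestor_def by auto
    also have "\<dots> \<longleftrightarrow> (\<forall>t\<in>P (fst y). snd x t = snd y t)"
    proof -
      have "snd y \<in> extensional (P (fst y))"
        using y unfolding branch_verts_def by (auto simp: PiE_def)
      then show ?thesis by (auto intro!: extensionalityI[of _ "P (fst y)"])
    qed
    also have "\<dots> \<longleftrightarrow> (\<forall>t\<in>P (fst x) \<inter> P (fst y). snd x t = snd y t)" using sub by auto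
    finally show ?thesis .
  qed
  show ?thesis
  proof (rule G_edge_cases[OF G])
    assume "ancestor T r (fst y) (fst x)" then show ?thesis using *[OF x y G] by simp
  next
    assume "ancestor T r (fst x) (fst y)"
    then have "{y, x} \<in> edges (branching T r k G) \<longleftrightarrow> (\<forall>t\<in>P (fst y) \<inter> P (fst x). snd y t = snd x t)"
      using *[OF y x] G by (simp add: insert_commute)
    then show ?thesis by (auto simp: insert_commute Int_commute)
  qed
qed

definition lifts :: "'b graph \<Rightarrow> ('b \<Rightarrow> 'a) \<Rightarrow> ('a \<Rightarrow> nat) \<Rightarrow> ('b \<Rightarrow> 'a \<times> ('a \<Rightarrow> nat)) set" where
  "lifts F \<sigma> k = {f \<in> verts F \<rightarrow>\<^sub>E branch_verts T r k.
     (\<forall>e\<in>edges F. f ` e \<in> edges (branching T r k G)) \<and> (\<forall>v\<in>verts F. fst (f v) = \<sigma> v)}"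

text \<open>Every homomorphism has exactly one projection, its first components restricted to
  \<open>verts F\<close>.\<close>

lemma hom_eq_sum_lifts:
  assumes F: "finite_graph F"
  shows "hom F (branching T r k G) = (\<Sum>\<sigma>\<in>verts F \<rightarrow>\<^sub>E V. card (lifts F \<sigma> k))"
proof -
  let ?S = "{f \<in> verts F \<rightarrow>\<^sub>E branch_verts T r k. \<forall>e\<in>edges F. f ` e \<in> edges (branching T r k G)}"
  have finF: "finite (verts F)" using F unfolding finite_graph_def by auto
  have fin: "finite (verts F \<rightarrow>\<^sub>E branch_verts T r k)" using finF finite_branch_verts by (auto intro: finite_PiE)
  have "?S = (\<Union>\<sigma>\<in>verts F \<rightarrow>\<^sub>E V. lifts F \<sigma> k)"
  proof (intro set_eqI iffI)
    fix f assume f: "f \<in> ?S"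
    have "fst (f v) \<in> V" if "v \<in> verts F" for v
    proof -
      have "f v \<in> branch_verts T r k" using f that by auto
      then show ?thesis unfolding branch_verts_def by auto
    qed
    then have "(\<lambda>v\<in>verts F. fst (f v)) \<in> verts F \<rightarrow>\<^sub>E V" by auto
    moreover have "f \<in> lifts F (\<lambda>v\<in>verts F. fst (f v)) k" using f unfolding lifts_def by auto
    ultimately show "f \<in> (\<Union>\<sigma>\<in>verts F \<rightarrow>\<^sub>E V. lifts F \<sigma> k)" by blast
  qed (auto simp: lifts_def)
  moreover have "card (\<Union>\<sigma>\<in>verts F \<rightarrow>\<^sub>E V. lifts F \<sigma> k) = (\<Sum>\<sigma>\<in>verts F \<rightarrow>\<^sub>E V. card (lifts F \<sigma> k))"
  proof (rule card_UN_disjoint)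
    show "finite (verts F \<rightarrow>\<^sub>E V)" using finF finite_V by (auto intro: finite_PiE)
    show "\<forall>\<sigma>\<in>verts F \<rightarrow>\<^sub>E V. finite (lifts F \<sigma> k)"
      using fin unfolding lifts_def by (auto intro: finite_subset)
    have "\<sigma> = \<tau>" if "\<sigma> \<in> verts F \<rightarrow>\<^sub>E V" "\<tau> \<in> verts F \<rightarrow>\<^sub>E V" "f \<in> lifts F \<sigma> k" "f \<in> lifts F \<tau> k" for \<sigma> \<tau> f
      by (rule PiE_ext[OF that(1,2)]) (use that(3,4) in \<open>auto simp: lifts_def\<close>)
    then show "\<forall>\<sigma>\<in>verts F \<rightarrow>\<^sub>E V. \<forall>\<tau>\<in>verts F \<rightarrow>\<^sub>E V. \<sigma> \<noteq> \<tau> \<longrightarrow> lifts F \<sigma> k \<inter> lifts F \<tau> k = {}" by blast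
  qed
  ultimately show ?thesis unfolding hom_def by (simp add: branching_def)
qed

text \<open>First components take edges of the branching to edges of \<open>G\<close>, so a map with
  a lift preserves edges.\<close>

lemma lifts_empty:
  assumes F: "finite_graph F" and e: "e \<in> edges F" "\<sigma> ` e \<notin> edges G"
  shows "lifts F \<sigma> k = {}"
proof -
  have False if f: "f \<in> lifts F \<sigma> k" for f
  proof -
    have "e \<subseteq> verts F" using F e unfolding finite_graph_def by auto
    then have "fst ` f ` e = \<sigma> ` e" using f unfolding lifts_def by (auto simp: image_image intro!: image_cong)
    moreover have "f ` e \<in> edges (branching T r k G)" using f e unfolding lifts_def by auto
    then have "fst ` f ` e \<in> edges G" unfolding branching_def by auto
    ultimately show False using e by simp
  qed
  then show ?thesis by blast
qed

text \<open>The pair \<open>(v, t)\<close> stands for the entry at \<open>t\<close> in the second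
  component of the image of \<open>v\<close>.\<close>

definition coords :: "'b graph \<Rightarrow> ('b \<Rightarrow> 'a) \<Rightarrow> ('b \<times> 'a) set" where
  "coords F \<sigma> = (SIGMA v:verts F. P (\<sigma> v))"

text \<open>By \<open>branching_edge_iff\<close> these equalities say that edges go to edges. They
  compare only coordinates with the same \<open>t\<close>, which have the same range.\<close>

definition constraints :: "'b graph \<Rightarrow> ('b \<Rightarrow> 'a) \<Rightarrow> (('b \<times> 'a) \<times> 'b \<times> 'a) set" where
  "constraints F \<sigma> = {((u, t), (v, t)) |u v t. {u, v} \<in> edges F \<and> t \<in> P (\<sigma> u) \<inter> P (\<sigma> v)}"

lemma card_lifts:
  assumes F: "finite_graph F" and \<sigma>: "\<sigma> \<in> verts F \<rightarrow>\<^sub>E V" and e: "\<forall>e\<in>edges F. \<sigma> ` e \<in> edges G"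
  shows "card (lifts F \<sigma> k) =
    card {\<phi> \<in> (\<Pi>\<^sub>E d\<in>coords F \<sigma>. {1..k (snd d)}). \<forall>(d, d')\<in>constraints F \<sigma>. \<phi> d = \<phi> d'}"
    (is "_ = card ?B")
proof -
  have edge_verts: "u \<in> verts F" "v \<in> verts F" if "{u, v} \<in> edges F" for u v
    using F that unfolding finite_graph_def by (metis doubleton_eq_iff)+
  have edge_ex: "\<exists>u v. e = {u, v}" if "e \<in> edges F" for e
    using F that unfolding finite_graph_def by meson
  have edge_iff: "f ` {u, v} \<in> edges (branching T r k G) \<longleftrightarrow>
      (\<forall>t\<in>P (\<sigma> u) \<inter> P (\<sigma> v). snd (f u) t = snd (f v) t)"
    if "f \<in> verts F \<rightarrow>\<^sub>E branch_verts T r k" "\<forall>v\<in>verts F. fst (f v) = \<sigma> v" "{u, v} \<in> edges F" for f u v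
  proof -
    have "{\<sigma> u, \<sigma> v} \<in> edges G" using e that(3) by fastforce
    then show ?thesis
      using branching_edge_iff[of "f u" k "f v"] that edge_verts[OF that(3)] PiE_mem[OF that(1)] by simp
  qed
  \<comment> \<open>Uncurrying and currying: \<open>\<alpha>\<close> reads off all coordinates of a
    lift, and \<open>\<beta>\<close> puts them together again over the prescribed first
    components.\<close>
  define \<alpha> where "\<alpha> f = (\<lambda>d\<in>coords F \<sigma>. snd (f (fst d)) (snd d))" for f :: "'b \<Rightarrow> 'a \<times> ('a \<Rightarrow> nat)"
  define \<beta> where "\<beta> \<phi> = (\<lambda>v\<in>verts F. (\<sigma> v, \<lambda>t\<in>P (\<sigma> v). \<phi> (v, t)))" for \<phi> :: "'b \<times> 'a \<Rightarrow> nat"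
  have f_v: "fst (f v) = \<sigma> v" "snd (f v) \<in> (\<Pi>\<^sub>E t\<in>P (\<sigma> v). {1..k t})"
    if "f \<in> lifts F \<sigma> k" "v \<in> verts F" for f v
  proof -
    show 1: "fst (f v) = \<sigma> v" using that unfolding lifts_def by auto
    have "f v \<in> branch_verts T r k" using that unfolding lifts_def by auto
    then show "snd (f v) \<in> (\<Pi>\<^sub>E t\<in>P (\<sigma> v). {1..k t})"
      unfolding branch_verts_def using 1 by (metis SigmaD2 prod.collapse)
  qed
  have "bij_betw \<alpha> (lifts F \<sigma> k) ?B"
  proof (rule bij_betw_byWitness[where f' = \<beta>])
    show "\<forall>f\<in>lifts F \<sigma> k. \<beta> (\<alpha> f) = f"
    proof
      fix f assume f: "f \<in> lifts F \<sigma> k"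
      show "\<beta> (\<alpha> f) = f"
      proof (rule extensionalityI[of _ "verts F"])
        show "f \<in> extensional (verts F)" using f unfolding lifts_def by (auto simp: PiE_def)
        fix v assume v: "v \<in> verts F"
        have "(\<lambda>t\<in>P (\<sigma> v). snd (f v) t) = snd (f v)"
          using f_v(2)[OF f v] by (simp add: PiE_def extensional_restrict)
        moreover have "(\<lambda>t\<in>P (\<sigma> v). \<alpha> f (v, t)) = (\<lambda>t\<in>P (\<sigma> v). snd (f v) t)"
          by (rule restrict_ext) (simp add: \<alpha>_def coords_def v)
        ultimately show "\<beta> (\<alpha> f) v = f v" using v f_v(1)[OF f v] unfolding \<beta>_def
          by (simp add: prod_eq_iff)
      qed (simp add: \<beta>_def)
    qed
    show "\<forall>\<phi>\<in>?B. \<alpha> (\<beta> \<phi>) = \<phi>"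
    proof
      fix \<phi> assume "\<phi> \<in> ?B"
      then have "\<phi> \<in> extensional (coords F \<sigma>)" by (simp add: PiE_def)
      then show "\<alpha> (\<beta> \<phi>) = \<phi>"
        by (intro extensionalityI[of _ "coords F \<sigma>"]) (auto simp: \<alpha>_def \<beta>_def coords_def)
    qed
    show "\<alpha> ` lifts F \<sigma> k \<subseteq> ?B"
    proof
      fix \<phi> assume "\<phi> \<in> \<alpha> ` lifts F \<sigma> k"
      then obtain f where f: "f \<in> lifts F \<sigma> k" "\<phi> = \<alpha> f" by auto
      have "\<alpha> f \<in> (\<Pi>\<^sub>E d\<in>coords F \<sigma>. {1..k (snd d)})"
      proof (rule PiE_I)
        fix d assume d: "d \<in> coords F \<sigma>"
        then have "fst d \<in> verts F" "snd d \<in> P (\<sigma> (fst d))" unfolding coords_def by auto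
        then show "\<alpha> f d \<in> {1..k (snd d)}"
          using PiE_mem[OF f_v(2)[OF f(1)]] d by (simp add: \<alpha>_def)
      qed (simp add: \<alpha>_def)
      moreover have "\<alpha> f d = \<alpha> f d'" if "(d, d') \<in> constraints F \<sigma>" for d d'
      proof -
        obtain u v t where d: "d = (u, t)" "d' = (v, t)" and uv: "{u, v} \<in> edges F"
          and t: "t \<in> P (\<sigma> u) \<inter> P (\<sigma> v)" using \<open>(d, d') \<in> constraints F \<sigma>\<close> unfolding constraints_def by auto
        have "f ` {u, v} \<in> edges (branching T r k G)" using f(1) uv unfolding lifts_def by blast
        then have "snd (f u) t = snd (f v) t"
          using edge_iff[of f u v] f(1) uv t unfolding lifts_def by blast
        then show ?thesis using edge_verts[OF uv] t d by (simp add: \<alpha>_def coords_def)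
      qed
      ultimately show "\<phi> \<in> ?B" using f by auto
    qed
    show "\<beta> ` ?B \<subseteq> lifts F \<sigma> k"
    proof
      fix f assume "f \<in> \<beta> ` ?B"
      then obtain \<phi> where \<phi>: "\<phi> \<in> ?B" "f = \<beta> \<phi>" by blast
      have \<phi>_PiE: "\<phi> \<in> (\<Pi>\<^sub>E d\<in>coords F \<sigma>. {1..k (snd d)})" using \<phi>(1) by blast
      have \<phi>_eq: "\<phi> d = \<phi> d'" if "(d, d') \<in> constraints F \<sigma>" for d d' using \<phi>(1) that by blast
      have "\<phi> (v, t) \<in> {1..k t}" if "v \<in> verts F" "t \<in> P (\<sigma> v)" for v t
        using PiE_mem[OF \<phi>_PiE, of "(v, t)"] that unfolding coords_def by simp
      then have f1: "f \<in> verts F \<rightarrow>\<^sub>E branch_verts T r k"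
        using PiE_mem[OF \<sigma>] unfolding \<phi>(2) \<beta>_def branch_verts_def by (auto intro!: PiE_I)
      have f2: "\<forall>v\<in>verts F. fst (f v) = \<sigma> v" unfolding \<phi>(2) \<beta>_def by simp
      have "f ` e \<in> edges (branching T r k G)" if e: "e \<in> edges F" for e
      proof -
        obtain u v where uv: "e = {u, v}" using edge_ex e by blast
        have "snd (f u) t = snd (f v) t" if "t \<in> P (\<sigma> u) \<inter> P (\<sigma> v)" for t
        proof -
          have "((u, t), (v, t)) \<in> constraints F \<sigma>" using that uv e unfolding constraints_def by blast
          then show ?thesis using \<phi>_eq that edge_verts e uv unfolding \<phi>(2) \<beta>_def by simp
        qed
        then show ?thesis using edge_iff[OF f1 f2, of u v] e uv by blast
      qed
      then show "f \<in> lifts F \<sigma> k" using f1 f2 unfolding lifts_def by blast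
    qed
  qed
  then show ?thesis by (rule bij_betw_same_card)
qed

end

text \<open>Coordinates and constraints do not involve \<open>k\<close>, so one set \<open>E\<close>
  of representatives serves all \<open>k\<close>.\<close>

lemma (in branching_target) card_lifts_monomial:
  fixes F :: "'b graph"
  assumes F: "finite_graph F" and \<sigma>: "\<sigma> \<in> verts F \<rightarrow>\<^sub>E V" and e: "\<forall>e\<in>edges F. \<sigma> ` e \<in> edges G"
  obtains E :: "('b \<times> 'a) set" where "finite E" "snd ` E \<subseteq> V" "\<And>k. card (lifts F \<sigma> k) = (\<Prod>d\<in>E. k (snd d))"
proof -
  have "finite (verts F)" using F unfolding finite_graph_def by auto
  then have fin: "finite (coords F \<sigma>)" unfolding coords_def using finite_P by auto
  have V: "snd ` coords F \<sigma> \<subseteq> V"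
    using PiE_mem[OF \<sigma>] P_subset_V unfolding coords_def by fastforce
  have "u \<in> verts F \<and> v \<in> verts F" if "{u, v} \<in> edges F" for u v
    using F that unfolding finite_graph_def by (metis doubleton_eq_iff)
  then have sub: "constraints F \<sigma> \<subseteq> coords F \<sigma> \<times> coords F \<sigma>"
    unfolding constraints_def coords_def by auto
  have eq: "snd d = snd d'" if "(d, d') \<in> constraints F \<sigma>" for d d'
    using that unfolding constraints_def by auto
  obtain E where E: "E \<subseteq> coords F \<sigma>" "\<And>k :: 'a \<Rightarrow> nat.
    card {\<phi> \<in> (\<Pi>\<^sub>E d\<in>coords F \<sigma>. {1..k (snd d)}). \<forall>(d, d')\<in>constraints F \<sigma>. \<phi> d = \<phi> d'}
      = (\<Prod>d\<in>E. k (snd d))"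
    by (rule card_PiE_equalities[OF fin sub, of snd]) (erule eq, rule that)
  show ?thesis
  proof (rule that)
    show "finite E" using E(1) fin by (rule finite_subset)
    show "snd ` E \<subseteq> V" using E(1) V by blast
    show "card (lifts F \<sigma> k) = (\<Prod>d\<in>E. k (snd d))" for k using card_lifts[OF assms] E(2) by simp
  qed
qed

text \<open>The sum runs over finitely many projections, again independent of \<open>k\<close>, and
  each contributes a monomial or 0.\<close>

lemma hom_branching_polynomial:
  fixes T :: "nat graph" and F :: "'b graph"
  assumes T: "rooted_tree T r" "verts T = {1..h}" "spanning_subgraph G (clos T r)"
    and F: "finite_graph F"
  shows "\<exists>p. polynomial_in h p \<and> (\<forall>k. of_nat (hom F (branching T r k G)) = p (\<lambda>i. of_nat (k i)))"
proof -
  interpret branching_target T r G using T by unfold_locales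
  have "\<exists>p. polynomial_in h p \<and> (\<forall>k. of_nat (card (lifts F \<sigma> k)) = p (\<lambda>i. of_nat (k i)))"
    if \<sigma>: "\<sigma> \<in> verts F \<rightarrow>\<^sub>E V" for \<sigma>
  proof (cases "\<forall>e\<in>edges F. \<sigma> ` e \<in> edges G")
    case True
    obtain E :: "('b \<times> nat) set" where E: "finite E" "snd ` E \<subseteq> V" "\<And>k. card (lifts F \<sigma> k) = (\<Prod>d\<in>E. k (snd d))"
      by (rule card_lifts_monomial[OF F \<sigma> True]) (rule that)
    then show ?thesis
      using polynomial_in_prod_vars[of E snd h] T(2)
      by (intro exI[of _ "\<lambda>x. \<Prod>d\<in>E. x (snd d)"]) simp
  next
    case False
    then have "\<And>k. lifts F \<sigma> k = {}" using lifts_empty[OF F] by blast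
    then show ?thesis using polynomial_in_zero by (intro exI[of _ "\<lambda>x. 0"]) simp
  qed
  then obtain p where p: "\<And>\<sigma>. \<sigma> \<in> verts F \<rightarrow>\<^sub>E V \<Longrightarrow> polynomial_in h (p \<sigma>)"
    "\<And>\<sigma> k. \<sigma> \<in> verts F \<rightarrow>\<^sub>E V \<Longrightarrow> of_nat (card (lifts F \<sigma> k)) = p \<sigma> (\<lambda>i. of_nat (k i))"
    by metis
  have "finite (verts F \<rightarrow>\<^sub>E V)"
    using F finite_V unfolding finite_graph_def by (auto intro: finite_PiE)
  then have "polynomial_in h (\<lambda>x. \<Sum>\<sigma>\<in>verts F \<rightarrow>\<^sub>E V. p \<sigma> x)" using p(1) by (rule polynomial_in_sum)
  moreover have "of_nat (hom F (branching T r k G)) = (\<Sum>\<sigma>\<in>verts F \<rightarrow>\<^sub>E V. p \<sigma> (\<lambda>i. of_nat (k i)))" for k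
    unfolding hom_eq_sum_lifts[OF F] of_nat_sum using p(2) by (intro sum.cong) auto
  ultimately show ?thesis by blast
qed

section \<open>Isomorphic graphs and the partition\<close>

text \<open>Finiteness of \<open>G\<close> includes that its edges are subsets of the vertex set,
  where the inverse of \<open>f\<close> undoes \<open>f\<close>.\<close>

lemma graph_iso_sym:
  assumes "finite_graph G" "G \<simeq>\<^sub>g H"
  shows "H \<simeq>\<^sub>g G"
proof -
  obtain f where f: "bij_betw f (verts G) (verts H)" "(\<lambda>e. f ` e) ` edges G = edges H"
    using assms(2) unfolding graph_iso_def is_graph_iso_def by blast
  have "inv_into (verts G) f ` f ` e = e" if "e \<in> edges G" for e
  proof -
    have "e \<subseteq> verts G" using assms(1) that unfolding finite_graph_def by auto
    then show ?thesis using f(1) by (simp add: bij_betw_def inv_into_image_cancel)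
  qed
  then have "(\<lambda>e. inv_into (verts G) f ` e) ` edges H = edges G"
    unfolding f(2)[symmetric] image_image by simp
  then show ?thesis
    using bij_betw_inv_into[OF f(1)] unfolding graph_iso_def is_graph_iso_def by blast
qed

lemma graph_iso_trans:
  assumes "G \<simeq>\<^sub>g H" "H \<simeq>\<^sub>g K"
  shows "G \<simeq>\<^sub>g K"
proof -
  obtain f g where f: "is_graph_iso f G H" and g: "is_graph_iso g H K"
    using assms unfolding graph_iso_def by blast
  have "(\<lambda>e. (g \<circ> f) ` e) ` edges G = (\<lambda>e. g ` e) ` (\<lambda>e. f ` e) ` edges G"
    by (simp add: image_image image_comp)
  then have "is_graph_iso (g \<circ> f) G K"
    using f g bij_betw_trans unfolding is_graph_iso_def by auto
  then show ?thesis unfolding graph_iso_def by blast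
qed

text \<open>Composition with the isomorphism is injective on homomorphisms. Used in both directions,
  this gives equality.\<close>

lemma hom_graph_iso_le:
  assumes F: "finite_graph F" and "finite_graph K" "H \<simeq>\<^sub>g K"
  shows "hom F H \<le> hom F K"
proof -
  obtain g where g: "bij_betw g (verts H) (verts K)" "(\<lambda>e. g ` e) ` edges H = edges K"
    using assms(3) unfolding graph_iso_def is_graph_iso_def by blast
  let ?A = "{f \<in> verts F \<rightarrow>\<^sub>E verts H. \<forall>e\<in>edges F. f ` e \<in> edges H}"
  let ?B = "{f \<in> verts F \<rightarrow>\<^sub>E verts K. \<forall>e\<in>edges F. f ` e \<in> edges K}"
  let ?c = "\<lambda>f. \<lambda>v\<in>verts F. g (f v)"
  have "inj_on ?c ?A"
  proof (rule inj_onI)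
    fix f f' assume f: "f \<in> ?A" "f' \<in> ?A" "?c f = ?c f'"
    show "f = f'"
    proof (rule PiE_ext[of f "verts F" "\<lambda>_. verts H" f'])
      fix v assume v: "v \<in> verts F"
      then have "g (f v) = g (f' v)" using fun_cong[OF f(3), of v] by simp
      moreover have "f v \<in> verts H" "f' v \<in> verts H" using f v by auto
      ultimately show "f v = f' v" using g(1) by (auto simp: bij_betw_def inj_on_def)
    qed (use f in auto)
  qed
  moreover have "?c ` ?A \<subseteq> ?B"
  proof
    fix q assume "q \<in> ?c ` ?A"
    then obtain f where f: "f \<in> ?A" "q = ?c f" by auto
    have "q ` e \<in> edges K" if "e \<in> edges F" for e
    proof -
      have "e \<subseteq> verts F" using F that unfolding finite_graph_def by auto
      then have "q ` e = g ` f ` e" unfolding f(2) by (auto simp: image_image intro!: image_cong)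
      then show ?thesis using f that g(2) by auto
    qed
    moreover have "q \<in> verts F \<rightarrow>\<^sub>E verts K"
      using f g(1) unfolding bij_betw_def by auto
    ultimately show "q \<in> ?B" by blast
  qed
  moreover have "finite (verts F \<rightarrow>\<^sub>E verts K)"
    using F assms(2) unfolding finite_graph_def by (auto intro: finite_PiE)
  then have "finite ?B" by (rule rev_finite_subset) blast
  ultimately show ?thesis unfolding hom_def by (rule card_inj_on_le)
qed

lemma hom_graph_iso:
  assumes "finite_graph F" "finite_graph H" "finite_graph K" "H \<simeq>\<^sub>g K"
  shows "hom F H = hom F K"
  using assms hom_graph_iso_le graph_iso_sym by (metis le_antisym)

text \<open>The vertices of a branching are pairs, whereas the ambient sequence in
  \<open>strongly_polynomial_subsequence\<close> consists of graphs on natural numbers.\<close>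

lemma ex_nat_copy:
  assumes "finite_graph G"
  shows "\<exists>K :: nat graph. finite_graph K \<and> K \<simeq>\<^sub>g G"
proof -
  have "finite (verts G)" using assms unfolding finite_graph_def by auto
  then obtain f :: "'a \<Rightarrow> nat" where f: "inj_on f (verts G)"
    using finite_imp_inj_to_nat_seg by metis
  let ?K = "\<lparr>verts = f ` verts G, edges = (\<lambda>e. f ` e) ` edges G\<rparr>"
  have "\<exists>u\<in>verts ?K. \<exists>v\<in>verts ?K. e = {u, v}" if e: "e \<in> edges ?K" for e
  proof -
    obtain e' where e': "e' \<in> edges G" "e = f ` e'" using e by auto
    then obtain u v where "u \<in> verts G" "v \<in> verts G" "e' = {u, v}"
      using assms unfolding finite_graph_def by meson
    then show ?thesis using e' by (intro bexI[of _ "f u"] bexI[of _ "f v"]) simp_all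
  qed
  then have K: "finite_graph ?K" using assms unfolding finite_graph_def by simp
  have "is_graph_iso f G ?K" using f unfolding is_graph_iso_def bij_betw_def by simp
  then have "?K \<simeq>\<^sub>g G" using graph_iso_sym[OF assms] unfolding graph_iso_def by blast
  then show ?thesis using K by blast
qed

lemma (in branching_target) finite_graph_branching: "finite_graph (branching T r k G)"
  unfolding finite_graph_def
proof (intro conjI ballI)
  show "finite (verts (branching T r k G))" using finite_branch_verts by (simp add: branching_def)
  fix e assume "e \<in> edges (branching T r k G)"
  then obtain x y where "e = {x, y}" "branch_ancestor T r k y x" unfolding branching_def by auto
  then show "\<exists>u\<in>verts (branching T r k G). \<exists>v\<in>verts (branching T r k G). e = {u, v}"
    by (intro bexI[of _ x] bexI[of _ y]) (simp_all add: branching_def branch_ancestor_def)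
qed

text \<open>The ambient sequence consists of copies of the branchings for all \<open>k\<close>, not
  only those in \<open>I\<close>.\<close>

lemma strongly_polynomial_subsequence_branching:
  fixes T :: "nat graph"
  assumes T: "rooted_tree T r" "verts T = {1..h}" "spanning_subgraph G (clos T r)"
    and I: "I \<subseteq> multi_indices h" and iso: "\<And>k. k \<in> I \<Longrightarrow> branching T r k G \<simeq>\<^sub>g F k"
  shows "strongly_polynomial_subsequence h I F"
proof -
  interpret branching_target T r G using T by unfold_locales
  have "\<forall>k. \<exists>K :: nat graph. finite_graph K \<and> K \<simeq>\<^sub>g branching T r k G"
    using ex_nat_copy finite_graph_branching by blast
  then obtain K :: "(nat \<Rightarrow> nat) \<Rightarrow> nat graph"
    where K: "\<And>k. finite_graph (K k)" "\<And>k. K k \<simeq>\<^sub>g branching T r k G" by metis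
  have "hom A (K k) = hom A (branching T r k G)" if "finite_graph A" for A :: "nat graph" and k
    using hom_graph_iso[OF that K(1) finite_graph_branching K(2)] .
  then have "strongly_polynomial h K"
    unfolding strongly_polynomial_def using K(1) hom_branching_polynomial[OF T] by fastforce
  moreover have "\<forall>k\<in>I. K k \<simeq>\<^sub>g F k" using graph_iso_trans[OF K(2) iso] by blast
  ultimately show ?thesis unfolding strongly_polynomial_subsequence_def using I by blast
qed

theorem theorem4p2:
  fixes \<H> :: "'a graph set"
  assumes "countable \<H>"
    and "\<forall>H\<in>\<H>. simple_graph H"
    and "\<exists>B :: nat. \<forall>H\<in>\<H>. min_branching_core_size H \<le> enat B"
  shows "\<exists>\<P>. finite \<P> \<and> partition_on \<H> \<P> \<and>
    (\<forall>\<H>'\<in>\<P>. \<exists>(h :: nat) (I :: (nat \<Rightarrow> nat) set) (F :: (nat \<Rightarrow> nat) \<Rightarrow> 'a graph).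
       1 \<le> h \<and> I \<subseteq> multi_indices h \<and>
       (\<forall>k\<in>I. F k \<in> \<H>') \<and> (\<forall>H\<in>\<H>'. \<exists>k\<in>I. H \<simeq>\<^sub>g F k) \<and>
       (\<exists>(T :: nat graph) r G.
          rooted_tree T r \<and> verts T = {1..h} \<and> spanning_subgraph G (clos T r) \<and>
          (\<forall>k\<in>I. F k \<simeq>\<^sub>g branching T r k G)) \<and>
       strongly_polynomial_subsequence h I F)"
proof -
  obtain B where B: "\<And>H. H \<in> \<H> \<Longrightarrow> min_branching_core_size H \<le> enat B" using assms(3) by blast
  define shape :: "nat \<times> nat graph \<times> nat \<times> nat graph \<Rightarrow> bool" where
    "shape = (\<lambda>(h, T, r, G). 1 \<le> h \<and> h \<le> B \<and> rooted_tree T r \<and> verts T = {1..h} \<and>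
       spanning_subgraph G (clos T r))"
  define fits :: "nat \<times> nat graph \<times> nat \<times> nat graph \<Rightarrow> (nat \<Rightarrow> nat) \<Rightarrow> 'a graph \<Rightarrow> bool" where
    "fits = (\<lambda>(h, T, r, G) k H. k \<in> multi_indices h \<and> H \<simeq>\<^sub>g branching T r k G)"
  have "\<exists>c k. shape c \<and> fits c k H" if H: "H \<in> \<H>" for H
  proof -
    obtain h k and T :: "nat graph" and r G where
      "1 \<le> h" "h \<le> B" "k \<in> multi_indices h" "rooted_tree T r" "verts T = {1..h}"
      "spanning_subgraph G (clos T r)" "H \<simeq>\<^sub>g branching T r k G"
      using graph_iso_branching_core[OF B[OF H]] .
    then have "shape (h, T, r, G) \<and> fits (h, T, r, G) k H" unfolding shape_def fits_def by simp
    then show ?thesis by blast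
  qed
  \<comment> \<open>Several shapes may fit one graph; \<open>c\<close> selects one, so that its
    fibres are disjoint.\<close>
  then obtain c where c: "\<And>H. H \<in> \<H> \<Longrightarrow> shape (c H)" "\<And>H. H \<in> \<H> \<Longrightarrow> \<exists>k. fits (c H) k H" by metis
  \<comment> \<open>A finite set containing every tree and every projected graph that occurs in a
    shape, since these have vertices between 1 and \<open>B\<close>.\<close>
  define \<G> :: "nat graph set" where
    "\<G> = (\<lambda>(A, E). \<lparr>verts = A, edges = E\<rparr>) ` (Pow {1..B} \<times> Pow (Pow {1..B}))"
  have \<G>: "K \<in> \<G>" if "verts K \<subseteq> {1..B}" "edges K \<subseteq> Pow {1..B}" for K :: "nat graph"
    unfolding \<G>_def using that by (intro image_eqI[of _ _ "(verts K, edges K)"]) auto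
  have "finite {c. shape c}"
  proof (rule finite_subset)
    show "finite ({1..B} \<times> \<G> \<times> {1..B} \<times> \<G>)" unfolding \<G>_def by simp
    show "{c. shape c} \<subseteq> {1..B} \<times> \<G> \<times> {1..B} \<times> \<G>"
    proof (rule subsetI, simp only: mem_Collect_eq)
      fix c assume "shape c"
      then obtain h T r G where c: "c = (h, T, r, G)" "1 \<le> h" "h \<le> B" "rooted_tree T r" "verts T = {1..h}"
        "spanning_subgraph G (clos T r)" unfolding shape_def by (cases c) auto
      interpret branching_target T r G using c by unfold_locales
      have V: "V \<subseteq> {1..B}" using c by auto
      have "e \<subseteq> V" if "e \<in> edges T" for e
        using that c(4) unfolding rooted_tree_def tree_def simple_graph_def finite_graph_def by auto
      then have "T \<in> \<G>" using V by (intro \<G>) auto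
      moreover have "e \<subseteq> V" if "e \<in> edges G" for e
        using that G_clos ancestor_V unfolding spanning_subgraph_def clos_def by auto
      then have "G \<in> \<G>" using V c(6) unfolding spanning_subgraph_def clos_def by (intro \<G>) auto
      ultimately show "c \<in> {1..B} \<times> \<G> \<times> {1..B} \<times> \<G>" using c root_V V by auto
    qed
  qed
  then have fin: "finite (c ` \<H>)" using c(1) by (elim rev_finite_subset) blast
  define cell where "cell d = {H \<in> \<H>. c H = d}" for d
  have "partition_on \<H> (cell ` c ` \<H>)"
    by (rule partition_onI) (auto simp: cell_def disjnt_def)
  moreover have "\<exists>(h :: nat) (I :: (nat \<Rightarrow> nat) set) (F :: (nat \<Rightarrow> nat) \<Rightarrow> 'a graph).
       1 \<le> h \<and> I \<subseteq> multi_indices h \<and>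
       (\<forall>k\<in>I. F k \<in> \<H>') \<and> (\<forall>H\<in>\<H>'. \<exists>k\<in>I. H \<simeq>\<^sub>g F k) \<and>
       (\<exists>(T :: nat graph) r G.
          rooted_tree T r \<and> verts T = {1..h} \<and> spanning_subgraph G (clos T r) \<and>
          (\<forall>k\<in>I. F k \<simeq>\<^sub>g branching T r k G)) \<and>
       strongly_polynomial_subsequence h I F" if cell: "\<H>' \<in> cell ` c ` \<H>" for \<H>'
  proof -
    obtain d where d: "\<H>' = cell d" "shape d" using cell c(1) by blast
    obtain h T r G where hT: "d = (h, T, r, G)" by (cases d)
    have T: "1 \<le> h" "rooted_tree T r" "verts T = {1..h}" "spanning_subgraph G (clos T r)"
      using d(2) unfolding hT shape_def by auto
    interpret branching_target T r G using T by unfold_locales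
    define I where "I = {k \<in> multi_indices h. \<exists>H\<in>\<H>'. H \<simeq>\<^sub>g branching T r k G}"
    \<comment> \<open>Isomorphic members of a cell have the same indices, so a single
      \<open>F k\<close> represents them all, and the indexing is up to isomorphism.\<close>
    define F where "F k = (SOME H. H \<in> \<H>' \<and> H \<simeq>\<^sub>g branching T r k G)" for k
    have F: "F k \<in> \<H>' \<and> F k \<simeq>\<^sub>g branching T r k G" if "k \<in> I" for k
      unfolding F_def by (rule someI_ex) (use that in \<open>auto simp: I_def\<close>)
    have fg: "finite_graph H" if "H \<in> \<H>'" for H
      using that assms(2) unfolding d(1) cell_def simple_graph_def by auto
    have iso_F: "branching T r k G \<simeq>\<^sub>g F k" if "k \<in> I" for k
      using F[OF that] graph_iso_sym fg by blast
    have "\<exists>k\<in>I. H \<simeq>\<^sub>g F k" if H: "H \<in> \<H>'" for H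
    proof -
      obtain k where k: "fits (c H) k H" using c(2)[of H] H unfolding d(1) cell_def by auto
      have "c H = (h, T, r, G)" using H d(1) hT unfolding cell_def by simp
      then have k: "k \<in> multi_indices h" "H \<simeq>\<^sub>g branching T r k G" using k unfolding fits_def by auto
      then have "k \<in> I" using H unfolding I_def by blast
      then show ?thesis using graph_iso_trans[OF k(2) iso_F] by blast
    qed
    moreover have I: "I \<subseteq> multi_indices h" unfolding I_def by auto
    moreover have "strongly_polynomial_subsequence h I F"
      using strongly_polynomial_subsequence_branching[OF T(2-4) I iso_F] .
    ultimately show ?thesis using T F
      by (intro exI[of _ h] exI[of _ I] exI[of _ F] conjI exI[of _ T] exI[of _ r] exI[of _ G]) auto
  qed
  ultimately show ?thesis using fin by (intro exI[of _ "cell ` c ` \<H>"]) auto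
qed

end
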